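(* Let $P\subseteq U$ be a polytope that is $\Phi$-placed and $\Psi$-appropriate, and let $\mathbf V$ be its vertex set. Then: (1) the vertex set of the symmetrization $\mathfrak G(P)$ is $\{\mathbf v g:\ (\mathbf v,g)\in \mathbf V\times\mathfrak G\}$; (2) for each $(\mathbf v,g)\in\mathbf V\times\mathfrak G$ we have $\operatorname{ncone}(\mathbf v g,\mathfrak G(P))=\kappa(\mathbf v,g)$, where $\kappa(\mathbf v,g):=g^{-1}\Phi\cap g^{-1}[\operatorname{ncone}(\mathbf v,P)]$. Hence $\mathfrak G(P)$ is a full-dimensional polytope in $U$.
   Context: Setting: $\mathbb R^d$ carries an inner product $[\cdot,\cdot]$; $V\subseteq\mathbb R^d$ is a linear subspace with orthogonal complement $V^\perp$; $W=\mathbb R^d/V^\perp$ (elements written via representatives); $\mathbf x_0\in V^\perp$ and $U=V+\mathbf x_0$. The pairing $W\times U\to\mathbb R$ is $\langle\mathbf w,\mathbf u\rangle=[\mathbf w,\mathbf u-\mathbf x_0]$, making $U$ and $W$ dual; $U$ is identified with $W$ via $\mathbf u\mapsto \mathbf u+V^\perp$. $\mathcal H$ is a finite set of linear hyperplanes in $W$ whose common intersection is a single point, such that the group $\mathfrak G\subseteq GL(W)$ generated by the reflections in the hyperplanes of $\mathcal H$ is finite (a finite reflection group). $\mathfrak G$ acts on $W$ on the left, and on $U$ on the right by $\langle g\mathbf w,\mathbf u\rangle=\langle\mathbf w,\mathbf u g\rangle$. $\Sigma(\mathcal H)$ is the (pointed, complete) fan in $W$ induced by $\mathcal H$; $\Phi$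 is a fixed chamber (maximal cone) of $\Sigma(\mathcal H)$, and $\Psi\subseteq U$ is the cone corresponding to $\Phi$ under the identification of $U$ with $W$. Interiors $(\cdot)^\circ$ are relative interiors. For a polytope $P\subseteq U$ and a nonempty face $F$, $\operatorname{ncone}(F,P)=\{\mathbf w\in W:\langle\mathbf w,\mathbf y\rangle\ge\langle\mathbf w,\mathbf y'\rangle\ \forall\mathbf y\in F,\mathbf y'\in P\}$. $P^\vee=\{\mathbf w\in W:\langle\mathbf w,\cdot\rangle\text{ is constant on }P\}$. $P$ is $\Phi$-placed if $P^\vee\cap\Phi^\circ\ne\emptyset$, and $\Psi$-appropriate if $P\subseteq\Psi^\circ$. The $\mathfrak G$-symmetrization is $\mathfrak G(P)=\operatorname{Conv}\{\mathbf x g:\ g\in\mathfrak G,\ \mathbf x\in P\}$.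
   Formalization: The set of hyperplanes is additionally assumed to be stable under the reflection group; without this the claim fails, e.g. for two of the three mirrors of the dihedral group of order 6, a 120-degree chamber and P a point off the third mirror. P is taken nonempty. *)

theory Defs
  imports "HOL-Analysis.Analysis" "HOL-Algebra.Generated_Groups"
begin

text \<open>
  The quotient \<open>W\<close> of the ambient space by the orthogonal complement of \<open>V\<close> is given by a
  type \<open>'w\<close> and a projection \<open>\<pi>\<close> onto it: \<open>\<pi> w\<close> is the class of the
  representative \<open>w\<close>. The last conjunct says that the inner product of \<open>'w\<close> is the one induced
  on the quotient, i.e. the one for which \<open>\<pi>\<close> restricts to an isometry from \<open>V\<close>; it determines
  the orthogonal reflections of \<open>W\<close>.
\<close>

definition quotient_projection ::
    "'a::euclidean_space set \<Rightarrow> ('a \<Rightarrow> 'w::real_inner) \<Rightarrow> bool" where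
  "quotient_projection V \<pi> \<longleftrightarrow>
     linear \<pi> \<and> surj \<pi> \<and> {x. \<pi> x = 0} = V\<^sup>\<bottom> \<and>
     (\<forall>v\<in>V. \<forall>v'\<in>V. \<pi> v \<bullet> \<pi> v' = v \<bullet> v')"

definition affine_translate :: "'a::real_vector set \<Rightarrow> 'a \<Rightarrow> 'a set" where
  "affine_translate V x0 = (\<lambda>v. v + x0) ` V"

text \<open>
  For \<open>u\<close> in \<open>U = V + x0\<close> the value does not depend on the chosen representative of \<open>\<omega>\<close>.
\<close>

definition pairing ::
    "('a::euclidean_space \<Rightarrow> 'w) \<Rightarrow> 'a \<Rightarrow> 'w \<Rightarrow> 'a \<Rightarrow> real" where
  "pairing \<pi> x0 \<omega> u = (SOME w. \<pi> w = \<omega>) \<bullet> (u - x0)"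

definition GL :: "('w::real_vector \<Rightarrow> 'w) monoid" where
  "GL = \<lparr>carrier = {f. linear f \<and> bij f}, monoid.mult = (\<circ>), one = id\<rparr>"

definition linear_hyperplane :: "'w::real_inner set \<Rightarrow> bool" where
  "linear_hyperplane h \<longleftrightarrow> (\<exists>a. a \<noteq> 0 \<and> h = {x. a \<bullet> x = 0})"

definition reflection :: "'w::real_inner \<Rightarrow> 'w \<Rightarrow> 'w" where
  "reflection a x = x - (2 * (a \<bullet> x) / (a \<bullet> a)) *\<^sub>R a"

definition reflection_group :: "'w::real_inner set set \<Rightarrow> ('w \<Rightarrow> 'w) set" where
  "reflection_group \<H> = generate GL {reflection a | a. a \<noteq> 0 \<and> {x. a \<bullet> x = 0} \<in> \<H>}"

definition closed_halfspaces :: "'w::real_inner set \<Rightarrow> 'w set set" where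
  "closed_halfspaces h = {{x. 0 \<le> a \<bullet> x} | a. a \<noteq> 0 \<and> h = {x. a \<bullet> x = 0}}"

text \<open>
  A cone of the fan is cut out by choosing, for each hyperplane, the hyperplane itself or one of
  its two closed sides.
\<close>

definition arrangement_fan :: "'w::real_inner set set \<Rightarrow> 'w set set" where
  "arrangement_fan \<H> =
     {(\<Inter>h\<in>\<H>. c h) | c. \<forall>h\<in>\<H>. c h = h \<or> c h \<in> closed_halfspaces h}"

definition chamber :: "'w::real_inner set set \<Rightarrow> 'w set \<Rightarrow> bool" where
  "chamber \<H> \<Phi> \<longleftrightarrow>
     \<Phi> \<in> arrangement_fan \<H> \<and> (\<forall>C\<in>arrangement_fan \<H>. \<Phi> \<subseteq> C \<longrightarrow> C = \<Phi>)"

text \<open>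
  The right action on \<open>U\<close>: \<open>right_act V \<pi> x0 u g\<close> is the unique \<open>u'\<close> in \<open>U\<close> with
  \<open>\<langle>g \<omega>, u\<rangle> = \<langle>\<omega>, u'\<rangle>\<close> for all \<open>\<omega>\<close>.
\<close>

definition right_act ::
    "'a::euclidean_space set \<Rightarrow> ('a \<Rightarrow> 'w) \<Rightarrow> 'a \<Rightarrow> 'a \<Rightarrow> ('w \<Rightarrow> 'w) \<Rightarrow> 'a" where
  "right_act V \<pi> x0 u g =
     (THE u'. u' \<in> affine_translate V x0 \<and>
        (\<forall>\<omega>. pairing \<pi> x0 (g \<omega>) u = pairing \<pi> x0 \<omega> u'))"

definition dual_cone ::
    "'a::euclidean_space set \<Rightarrow> ('a \<Rightarrow> 'w) \<Rightarrow> 'a \<Rightarrow> 'w set \<Rightarrow> 'a set" where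
  "dual_cone V \<pi> x0 \<Phi> = {u \<in> affine_translate V x0. \<pi> u \<in> \<Phi>}"

definition ncone ::
    "('a::euclidean_space \<Rightarrow> 'w) \<Rightarrow> 'a \<Rightarrow> 'a set \<Rightarrow> 'a set \<Rightarrow> 'w set" where
  "ncone \<pi> x0 F P = {\<omega>. \<forall>y\<in>F. \<forall>y'\<in>P. pairing \<pi> x0 \<omega> y \<ge> pairing \<pi> x0 \<omega> y'}"

definition constancy_space ::
    "('a::euclidean_space \<Rightarrow> 'w) \<Rightarrow> 'a \<Rightarrow> 'a set \<Rightarrow> 'w set" where
  "constancy_space \<pi> x0 P = {\<omega>. pairing \<pi> x0 \<omega> constant_on P}"

definition placed ::
    "('a::euclidean_space \<Rightarrow> 'w::real_normed_vector) \<Rightarrow> 'a \<Rightarrow> 'w set \<Rightarrow> 'a set \<Rightarrow> bool" where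
  "placed \<pi> x0 \<Phi> P \<longleftrightarrow> constancy_space \<pi> x0 P \<inter> rel_interior \<Phi> \<noteq> {}"

definition appropriate :: "'a::euclidean_space set \<Rightarrow> 'a set \<Rightarrow> bool" where
  "appropriate \<Psi> P \<longleftrightarrow> P \<subseteq> rel_interior \<Psi>"

definition symmetrization ::
    "'a::euclidean_space set \<Rightarrow> ('a \<Rightarrow> 'w) \<Rightarrow> 'a \<Rightarrow> ('w \<Rightarrow> 'w) set \<Rightarrow> 'a set \<Rightarrow> 'a set" where
  "symmetrization V \<pi> x0 G P = convex hull {right_act V \<pi> x0 x g | x g. g \<in> G \<and> x \<in> P}"

definition \<kappa> ::
    "('a::euclidean_space \<Rightarrow> 'w) \<Rightarrow> 'a \<Rightarrow> 'w set \<Rightarrow> 'a set \<Rightarrow> 'a \<Rightarrow> ('w \<Rightarrow> 'w) \<Rightarrow> 'w set" where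
  "\<kappa> \<pi> x0 \<Phi> P v g = g -` \<Phi> \<inter> g -` ncone \<pi> x0 {v} P"

end

theory Submission
  imports Defs
begin

text \<open>
  Normalizing the normals of the hyperplanes at an interior point \<open>y0\<close> of \<open>\<Phi>\<close> turns simplicity
  into a minimality property and gives, by the exchange argument, that the group acts simply
  transitively on chambers; hence \<open>g x \<bullet> y < x \<bullet> y\<close> for \<open>x\<close>, \<open>y\<close> in the interior of
  \<open>\<Phi>\<close> and \<open>g \<noteq> id\<close>.

  Applied to a point \<open>w0\<close> of the interior of \<open>\<Phi>\<close> that is constant on \<open>P\<close>, the strict inequality
  shows that \<open>P\<close> is the face of the symmetrization on which \<open>w0\<close> is maximal, so vertices of
  \<open>P\<close> remain vertices. For \<open>v\<close> in \<open>P\<close>, the weak inequality shows that \<open>\<Phi>\<close> intersected with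
  the normal cone of \<open>v\<close> in \<open>P\<close> lies in the normal cone in the symmetrization; conversely a
  functional maximal at \<open>v\<close> is at least as large there as at the reflections of \<open>v\<close>, which puts
  it into \<open>\<Phi>\<close>. Since \<open>\<Phi>\<close> is pointed, no nonzero functional is constant on the symmetrization.
\<close>

section \<open>Reflections and the exchange argument\<close>

lemma reflection_inner_reflection: "reflection a x \<bullet> reflection a y = x \<bullet> y"
  by (cases "a = 0") (simp_all add: reflection_def inner_diff inner_commute)

lemma reflection_involutive [simp]: "reflection a (reflection a x) = x"
  by (cases "a = 0") (simp_all add: reflection_def inner_diff inner_commute)

lemma reflection_inner_swap: "reflection a x \<bullet> y = x \<bullet> reflection a y"
  by (simp add: reflection_def inner_diff inner_commute)

lemma linear_reflection: "linear (reflection a)"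
  by (rule linearI) (simp_all add: reflection_def inner_add_right distrib_left add_divide_distrib scaleR_add_left scaleR_diff_right)

lemma reflection_scaleR_normal:
  assumes "c \<noteq> 0" shows "reflection (c *\<^sub>R a) = reflection a"
  using assms by (auto simp: reflection_def fun_eq_iff)

lemma reflection_normal [simp]: "reflection a a = - a"
  by (cases "a = 0") (simp_all add: reflection_def scaleR_2)

text \<open>Subtracting from \<open>a\<close> its projection onto \<open>b\<close> leaves a vector
  \<open>z\<close> in the common hyperplane; being orthogonal to both \<open>a\<close> and
  \<open>b\<close>, it is orthogonal to itself.\<close>

lemma normals_parallel:
  fixes a b :: "'w::real_inner"
  assumes "{x. a \<bullet> x = 0} = {x. b \<bullet> x = 0}" "b \<noteq> 0"
  shows "\<exists>c. a = c *\<^sub>R b"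
proof -
  define z where "z = a - ((a \<bullet> b) / (b \<bullet> b)) *\<^sub>R b"
  have "b \<bullet> z = 0"
    using assms(2) by (simp add: z_def inner_diff inner_commute)
  moreover from this have "a \<bullet> z = 0"
    using assms(1) by auto
  ultimately have "z \<bullet> z = 0"
    by (subst z_def) (simp add: inner_diff_left)
  then show ?thesis
    unfolding z_def by auto
qed

text \<open>Lists of normals stand for group elements so that word length is available for
  induction; reversing a list inverts the element, since every letter is an involution.\<close>

definition reflection_word :: "'w::real_inner list \<Rightarrow> 'w \<Rightarrow> 'w" where
  "reflection_word ns = foldr (\<lambda>n f. reflection n \<circ> f) ns id"

lemma reflection_word_Nil [simp]: "reflection_word [] = id"
  by (simp add: reflection_word_def)

lemma reflection_word_Cons [simp]:
  "reflection_word (n # ns) = reflection n \<circ> reflection_word ns"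
  by (simp add: reflection_word_def)

lemma reflection_word_append [simp]:
  "reflection_word (ms @ ns) = reflection_word ms \<circ> reflection_word ns"
  by (induction ms) (auto simp: comp_assoc)

lemma linear_reflection_word: "linear (reflection_word ns)"
proof (induction ns)
  case Nil
  show ?case by (simp only: reflection_word_Nil linear_id)
next
  case (Cons n ns)
  then show ?case by (simp only: reflection_word_Cons linear_compose linear_reflection)
qed

lemma reflection_word_inner: "reflection_word ns x \<bullet> reflection_word ns y = x \<bullet> y"
  by (induction ns) (simp_all add: reflection_inner_reflection)

lemma reflection_word_rev_left [simp]: "reflection_word (rev ns) (reflection_word ns x) = x"
  by (induction ns arbitrary: x) simp_all

lemma reflection_word_rev_right [simp]: "reflection_word ns (reflection_word (rev ns) x) = x"
  using reflection_word_rev_left[of "rev ns" x] by simp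

lemma reflection_word_inner_swap: "reflection_word ns x \<bullet> y = x \<bullet> reflection_word (rev ns) y"
  by (metis reflection_word_inner reflection_word_rev_right)

lemma reflection_word_conj:
  "reflection (reflection_word ns a) (reflection_word ns x) = reflection_word ns (reflection a x)"
proof -
  interpret linear "reflection_word ns" by (rule linear_reflection_word)
  show ?thesis
    by (simp add: reflection_def diff scale reflection_word_inner)
qed

section \<open>Simple normals and the strict inequality along orbits\<close>

lemma finite_has_minimizer:
  fixes f :: "'b \<Rightarrow> real"
  assumes "finite A" "A \<noteq> {}"
  obtains a where "a \<in> A" "\<And>x. x \<in> A \<Longrightarrow> f a \<le> f x"
proof -
  have "Min (f ` A) \<in> f ` A" using assms by simp
  then obtain a where "a \<in> A" "f a = Min (f ` A)" by auto
  then show ?thesis using assms by (intro that[of a]) simp_all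
qed

lemma finite_has_maximizer:
  fixes f :: "'b \<Rightarrow> real"
  assumes "finite A" "A \<noteq> {}"
  obtains a where "a \<in> A" "\<And>x. x \<in> A \<Longrightarrow> f x \<le> f a"
  using finite_has_minimizer[OF assms, of "\<lambda>x. - f x"] by auto

text \<open>\<open>N\<close> acts as a positive root system scaled at \<open>y0\<close> instead of
  in length. Reflections therefore permute normals only up to a factor \<open>c\<close>, and the
  sign of \<open>c\<close> is the sign of the image at \<open>y0\<close>.\<close>

locale reflection_normals =
  fixes N :: "'w::real_inner set" and y0 :: 'w
  assumes finite_normals: "finite N"
    and normalized: "n \<in> N \<Longrightarrow> n \<bullet> y0 = 1"
    and reflection_closed: "m \<in> N \<Longrightarrow> n \<in> N \<Longrightarrow> \<exists>c k. k \<in> N \<and> reflection n m = c *\<^sub>R k"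
    and finite_words: "finite {reflection_word ns | ns. set ns \<subseteq> N}"
begin

text \<open>Taken as the definition is a known property of simple roots: the reflection in one of
  them keeps every other positive root positive.\<close>

definition simple :: "'w \<Rightarrow> bool" where
  "simple n \<longleftrightarrow> n \<in> N \<and> (\<forall>m\<in>N. m \<noteq> n \<longrightarrow> 0 < reflection n m \<bullet> y0)"

lemma normal_nonzero: "n \<in> N \<Longrightarrow> n \<noteq> 0"
  using normalized by force

lemma simple_normal: "simple n \<Longrightarrow> n \<in> N"
  by (simp add: simple_def)

text \<open>Closure under single reflections is iterated along the word; the factors stay nonzero
  because an involution cannot kill a nonzero normal.\<close>

lemma word_normal:
  assumes "set ns \<subseteq> N" "n \<in> N"
  shows "\<exists>c k. k \<in> N \<and> c \<noteq> 0 \<and> reflection_word ns n = c *\<^sub>R k"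
  using assms(1)
proof (induction ns)
  case Nil
  then show ?case using assms(2) by (intro exI[of _ 1] exI[of _ n]) simp
next
  case (Cons a ns)
  then obtain c k where k: "k \<in> N" "c \<noteq> 0" "reflection_word ns n = c *\<^sub>R k" by auto
  obtain d l where l: "l \<in> N" "reflection a k = d *\<^sub>R l"
    using reflection_closed[of k a] k Cons.prems by auto
  have "d \<noteq> 0"
    using l k reflection_involutive[of a k] normal_nonzero[of k]
    by (auto simp: reflection_def)
  then show ?case
    using k l linear_scale[OF linear_reflection, of a c k]
    by (intro exI[of _ "c * d"] exI[of _ l]) simp
qed

text \<open>
  Since all normals are normalized at \<open>y0\<close>, a non-simple normal is a proper convex combination of
  two others, so a lexicographic minimum of \<open>n \<bullet> z\<close> and then \<open>- n \<bullet> n\<close> is simple.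
\<close>
lemma negative_simple_normal:
  assumes "n1 \<in> N" "n1 \<bullet> z < 0"
  shows "\<exists>n. simple n \<and> n \<bullet> z < 0"
proof -
  obtain n0 where n0: "n0 \<in> N" "\<And>m. m \<in> N \<Longrightarrow> n0 \<bullet> z \<le> m \<bullet> z"
    using finite_has_minimizer[of N "\<lambda>m. m \<bullet> z"] finite_normals assms(1) by blast
  define N0 where "N0 = {n \<in> N. n \<bullet> z = n0 \<bullet> z}"
  have fin: "finite N0" "N0 \<noteq> {}"
    using n0(1) finite_normals by (auto simp: N0_def)
  obtain n where n: "n \<in> N0" "\<And>m. m \<in> N0 \<Longrightarrow> m \<bullet> m \<le> n \<bullet> n"
    using finite_has_maximizer[of N0 "\<lambda>m. m \<bullet> m"] fin by blast
  have nN: "n \<in> N" and nz: "n \<bullet> z = n0 \<bullet> z" using n(1) by (auto simp: N0_def)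
  have "simple n"
  proof (rule ccontr)
    assume "\<not> simple n"
    then obtain m where m: "m \<in> N" "m \<noteq> n" "reflection n m \<bullet> y0 \<le> 0"
      using nN by (auto simp: simple_def not_less)
    obtain c k where k: "k \<in> N" "c \<noteq> 0" "reflection n m = c *\<^sub>R k"
      using word_normal[of "[n]" m] nN m(1) by auto
    have "c < 0" using m(3) k normalized[OF k(1)] by simp
    define t where "t = 2 * (n \<bullet> m) / (n \<bullet> n)"
    have eq: "m - t *\<^sub>R n = c *\<^sub>R k" using k(3) by (simp add: reflection_def t_def)
    have "(m - t *\<^sub>R n) \<bullet> y0 = c" using eq normalized[OF k(1)] by simp
    then have t: "t = 1 - c"
      using normalized[OF m(1)] normalized[OF nN] by (simp add: inner_diff_left)
    \<comment> \<open>Evaluation at \<open>y0\<close> has given \<open>t = 1 - c\<close>; as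
      \<open>c < 0\<close>, dividing by \<open>1 - c\<close> exhibits \<open>n\<close> as a convex
      combination of \<open>m\<close> and \<open>k\<close> with positive weights.\<close>
    have comb: "(1 - c) * (n \<bullet> x) = m \<bullet> x + (- c) * (k \<bullet> x)" for x
    proof -
      have "(m - t *\<^sub>R n) \<bullet> x = c * (k \<bullet> x)" using eq by simp
      then show ?thesis using t by (simp add: inner_diff_left algebra_simps)
    qed
    have mz: "n \<bullet> z \<le> m \<bullet> z" and kz: "n \<bullet> z \<le> k \<bullet> z" using n0 m(1) k(1) nz by auto
    have "(m \<bullet> z - n \<bullet> z) + (- c) * (k \<bullet> z - n \<bullet> z) = 0"
      using comb[of z] by (simp add: algebra_simps)
    moreover have "0 \<le> (- c) * (k \<bullet> z - n \<bullet> z)" using \<open>c < 0\<close> kz by (simp add: mult_nonpos_nonneg)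
    ultimately have "m \<bullet> z = n \<bullet> z" "(- c) * (k \<bullet> z - n \<bullet> z) = 0" using mz by linarith+
    then have "m \<in> N0" "k \<in> N0" using m k nz by (auto simp: N0_def)
    then have le: "m \<bullet> m \<le> n \<bullet> n" "k \<bullet> k \<le> n \<bullet> n" using n(2) by auto
    \<comment> \<open>Vectors no longer than \<open>n\<close> have inner product at most
      \<open>n \<bullet> n\<close> with \<open>n\<close>, strictly less in the case of
      \<open>m\<close>; the combination tested on \<open>n\<close> itself then fails.\<close>
    have "0 < (m - n) \<bullet> (m - n)" using m(2) by simp
    then have mn: "m \<bullet> n < n \<bullet> n" using le(1) by (simp add: inner_diff inner_commute)
    have "0 \<le> (k - n) \<bullet> (k - n)" by simp
    then have kn: "k \<bullet> n \<le> n \<bullet> n" using le(2) by (simp add: inner_diff inner_commute)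
    have "(- c) * (k \<bullet> n) \<le> (- c) * (n \<bullet> n)" using kn \<open>c < 0\<close> by simp
    then show False using comb[of n] mn by (simp add: algebra_simps)
  qed
  moreover have "n \<bullet> z < 0" using nz n0(2)[OF assms(1)] assms(2) by simp
  ultimately show ?thesis by blast
qed

lemma simple_word_subset: "set ns \<subseteq> Collect simple \<Longrightarrow> set ns \<subseteq> N"
  using simple_normal by auto

text \<open>A positive image of \<open>m\<close> under simple words that is lowest at
  \<open>y0\<close> must be a multiple of a simple normal, as a simple reflection would otherwise
  lower it further. Conjugating back by the word then expresses \<open>reflection m\<close>.\<close>

lemma reflection_as_simple_word:
  assumes "m \<in> N"
  shows "\<exists>ns. set ns \<subseteq> Collect simple \<and> reflection m = reflection_word ns"
proof -
  define B where "B = {b. 0 < b \<bullet> y0 \<and> (\<exists>ns. set ns \<subseteq> Collect simple \<and> b = reflection_word ns m)}"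
  have "B \<subseteq> (\<lambda>f. f m) ` {reflection_word ns | ns. set ns \<subseteq> N}"
    using simple_word_subset by (fastforce simp: B_def)
  then have "finite B" using finite_words finite_surj by blast
  moreover have "m \<in> B" using assms normalized[of m] by (auto simp: B_def intro!: exI[of _ "[]"])
  ultimately obtain b where b: "b \<in> B" "\<And>a. a \<in> B \<Longrightarrow> b \<bullet> y0 \<le> a \<bullet> y0"
    using finite_has_minimizer[of B "\<lambda>a. a \<bullet> y0"] by blast
  obtain ns where ns: "set ns \<subseteq> Collect simple" "b = reflection_word ns m"
    using b(1) by (auto simp: B_def)
  obtain c k where k: "k \<in> N" "c \<noteq> 0" "b = c *\<^sub>R k"
    using word_normal[OF simple_word_subset[OF ns(1)] assms] ns(2) by auto
  have "0 < c" using b(1) k normalized[OF k(1)] by (simp add: B_def)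
  \<comment> \<open>Testing with \<open>- b\<close> yields a simple \<open>a\<close> with
    \<open>a \<bullet> b > 0\<close>, so reflecting in \<open>a\<close> lowers \<open>b\<close> at
    \<open>y0\<close>.\<close>
  have "k \<bullet> (- b) < 0" using k \<open>0 < c\<close> normal_nonzero[OF k(1)] by simp
  then obtain a where a: "simple a" "a \<bullet> (- b) < 0"
    using negative_simple_normal[OF k(1)] by blast
  have "k = a"
  proof (rule ccontr)
    assume "k \<noteq> a"
    then have "0 < reflection a k \<bullet> y0" using a(1) k(1) by (simp add: simple_def)
    then have "0 < reflection a b \<bullet> y0"
      using k(3) \<open>0 < c\<close> linear_scale[OF linear_reflection, of a c k] by simp
    then have "reflection a b \<in> B"
      using ns a(1) by (auto simp: B_def intro!: exI[of _ "a # ns"])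
    then have "b \<bullet> y0 \<le> reflection a b \<bullet> y0" by (rule b(2))
    moreover have "0 < 2 * (a \<bullet> b) / (a \<bullet> a)"
      using a normal_nonzero[OF simple_normal[OF a(1)]] by simp
    ultimately show False
      using normalized[OF simple_normal[OF a(1)]] by (simp add: reflection_def inner_diff_left)
  qed
  then have refl: "reflection a = reflection b" using k reflection_scaleR_normal[of c k] by simp
  have "reflection m x = reflection_word (rev ns @ a # ns) x" for x
    using reflection_word_conj[of ns m x] ns(2) refl by simp
  then show ?thesis
    using a(1) ns(1) by (intro exI[of _ "rev ns @ a # ns"]) auto
qed

lemma word_as_simple_word:
  assumes "set ms \<subseteq> N"
  shows "\<exists>ns. set ns \<subseteq> Collect simple \<and> reflection_word ms = reflection_word ns"
  using assms
proof (induction ms)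
  case Nil
  then show ?case by (intro exI[of _ "[]"]) simp
next
  case (Cons m ms)
  then obtain ns where ns: "set ns \<subseteq> Collect simple" "reflection_word ms = reflection_word ns"
    by auto
  obtain ls where ls: "set ls \<subseteq> Collect simple" "reflection m = reflection_word ls"
    using reflection_as_simple_word[of m] Cons.prems by (metis list.set_intros(1) subset_code(1))
  show ?case using ns ls by (intro exI[of _ "ls @ ns"]) simp
qed

text \<open>Applied from the right end of the word, the letters carry \<open>a\<close> from positive
  to nonpositive at \<open>y0\<close>. The letter \<open>b\<close> at the change of sign is simple,
  so the image of \<open>a\<close> just before it is a multiple of \<open>b\<close>; by conjugation
  that letter cancels against the appended \<open>reflection a\<close>.\<close>

lemma exchange:
  assumes "simple a" "set ns \<subseteq> Collect simple" "reflection_word ns a \<bullet> y0 \<le> 0"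
  shows "\<exists>ms. set ms \<subseteq> Collect simple \<and> length ms < length ns \<and>
    reflection_word ns \<circ> reflection a = reflection_word ms"
  using assms(2,3)
proof (induction ns)
  case Nil
  then show ?case using normalized[OF simple_normal[OF assms(1)]] by simp
next
  case (Cons b ns)
  have sb: "simple b" and sns: "set ns \<subseteq> Collect simple" using Cons.prems by auto
  show ?case
  proof (cases "reflection_word ns a \<bullet> y0 \<le> 0")
    case True
    then obtain ms where "set ms \<subseteq> Collect simple" "length ms < length ns"
      "reflection_word ns \<circ> reflection a = reflection_word ms"
      using Cons.IH sns by metis
    then show ?thesis using sb by (intro exI[of _ "b # ms"]) (simp add: fun_eq_iff)
  next
    case False
    obtain c k where k: "k \<in> N" "c \<noteq> 0" "reflection_word ns a = c *\<^sub>R k"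
      using word_normal[OF simple_word_subset[OF sns] simple_normal[OF assms(1)]] by auto
    have "0 < c" using False k normalized[OF k(1)] by simp
    have "c * (reflection b k \<bullet> y0) \<le> 0"
      using Cons.prems(2) k(3) linear_scale[OF linear_reflection, of b c k] by simp
    then have "\<not> 0 < reflection b k \<bullet> y0" using \<open>0 < c\<close> by (simp add: mult_le_0_iff)
    then have "k = b" using sb k(1) by (auto simp: simple_def)
    then have "reflection b = reflection (reflection_word ns a)"
      using k reflection_scaleR_normal[of c k] by simp
    then have "reflection_word (b # ns) \<circ> reflection a = reflection_word ns"
      using reflection_word_conj[of ns a] by (auto simp: fun_eq_iff)
    with sns show ?thesis by (intro exI[of _ ns]) (simp del: reflection_word_Cons)
  qed
qed

text \<open>In a nonempty word of this kind the part before the last letter \<open>a\<close> makes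
  \<open>a\<close> negative, so exchange provides a shorter word for the same element.\<close>

lemma positive_simple_word:
  assumes "set ns \<subseteq> Collect simple" "\<And>n. n \<in> N \<Longrightarrow> 0 < reflection_word ns n \<bullet> y0"
  shows "reflection_word ns = id"
  using assms
proof (induction "length ns" arbitrary: ns rule: less_induct)
  case less
  show ?case
  proof (cases ns rule: rev_cases)
    case Nil
    then show ?thesis by simp
  next
    case (snoc ms a)
    have sa: "simple a" and sms: "set ms \<subseteq> Collect simple" using less.prems snoc by auto
    have "0 < reflection_word ms (reflection a a) \<bullet> y0"
      using less.prems(2)[OF simple_normal[OF sa]] snoc by simp
    then have "reflection_word ms a \<bullet> y0 \<le> 0"
      using linear_neg[OF linear_reflection_word, of ms a] by simp
    then obtain ls where ls: "set ls \<subseteq> Collect simple" "length ls < length ms"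
      "reflection_word ms \<circ> reflection a = reflection_word ls"
      using exchange[OF sa sms] by auto
    then have eq: "reflection_word ns = reflection_word ls" using snoc by simp
    then show ?thesis using less.hyps[of ls] less.prems(2) ls snoc by simp
  qed
qed

text \<open>If \<open>x\<close> and its image both lie in the open chamber, invariance of the inner
  product forces positive factors on the permuted normals, so no normal changes sign.\<close>

lemma word_simply_transitive:
  assumes "set ns \<subseteq> N" "\<And>n. n \<in> N \<Longrightarrow> 0 < n \<bullet> x" "\<And>n. n \<in> N \<Longrightarrow> 0 < n \<bullet> reflection_word ns x"
  shows "reflection_word ns = id"
proof -
  obtain ms where ms: "set ms \<subseteq> Collect simple" "reflection_word ns = reflection_word ms"
    using word_as_simple_word[OF assms(1)] by auto
  have "0 < reflection_word ms n \<bullet> y0" if n: "n \<in> N" for n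
  proof -
    obtain c k where k: "k \<in> N" "reflection_word ns n = c *\<^sub>R k"
      using word_normal[OF assms(1) n] by auto
    have "0 < c * (k \<bullet> reflection_word ns x)"
      using reflection_word_inner[of ns n x] assms(2)[OF n] k by simp
    then have "0 < c" using assms(3)[OF k(1)] by (simp add: zero_less_mult_iff)
    then show ?thesis using k ms(2) normalized[OF k(1)] by simp
  qed
  then show ?thesis using positive_simple_word[OF ms(1)] ms(2) by simp
qed

text \<open>The identity is the only maximizer of \<open>g x \<bullet> y\<close> over the finite
  group: comparing a maximizer \<open>g\<close> with \<open>reflection n \<circ> g\<close> puts
  \<open>g x\<close> on the nonnegative side of every hyperplane, and the orbit of \<open>x\<close>
  avoids the hyperplanes, so \<open>g x\<close> is in the open chamber.\<close>

lemma word_inner_less: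
  assumes "set ns \<subseteq> N" "reflection_word ns \<noteq> id"
    and x: "\<And>n. n \<in> N \<Longrightarrow> 0 < n \<bullet> x" and y: "\<And>n. n \<in> N \<Longrightarrow> 0 < n \<bullet> y"
  shows "reflection_word ns x \<bullet> y < x \<bullet> y"
proof -
  let ?G = "{reflection_word ns | ns. set ns \<subseteq> N}"
  have mem: "id \<in> ?G" "reflection_word ns \<in> ?G"
    using assms(1) by (auto intro: exI[of _ "[]"])
  have max_id: "g = id" if g: "g \<in> ?G" "\<And>f. f \<in> ?G \<Longrightarrow> f x \<bullet> y \<le> g x \<bullet> y" for g
  proof -
    obtain ms where ms: "set ms \<subseteq> N" "g = reflection_word ms" using g(1) by auto
    have "0 < n \<bullet> g x" if n: "n \<in> N" for n
    proof -
      have "reflection n \<circ> g \<in> ?G" using ms n by (auto intro!: exI[of _ "n # ms"])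
      from g(2)[OF this] have "0 \<le> (2 * (n \<bullet> g x) / (n \<bullet> n)) * (n \<bullet> y)"
        by (simp add: reflection_def inner_diff_left)
      moreover have "0 < n \<bullet> n" using normal_nonzero[OF n] by simp
      ultimately have "0 \<le> n \<bullet> g x" using y[OF n] by (simp add: zero_le_mult_iff zero_le_divide_iff)
      \<comment> \<open>The inverse word takes \<open>n\<close> to a nonzero multiple of a normal,
        and no normal vanishes at \<open>x\<close>.\<close>
      moreover have "n \<bullet> g x \<noteq> 0"
      proof -
        obtain c k where "k \<in> N" "c \<noteq> 0" "reflection_word (rev ms) n = c *\<^sub>R k"
          using word_normal[of "rev ms" n] ms(1) n by auto
        then show ?thesis
          using reflection_word_inner_swap[of "rev ms" n x] x[of k] ms(2) by auto
      qed
      ultimately show ?thesis by simp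
    qed
    then show ?thesis using word_simply_transitive[OF ms(1) x] ms(2) by simp
  qed
  obtain g where g: "g \<in> ?G" "\<And>f. f \<in> ?G \<Longrightarrow> f x \<bullet> y \<le> g x \<bullet> y"
    using finite_has_maximizer[of ?G "\<lambda>f. f x \<bullet> y"] finite_words mem(1) by blast
  have le: "f x \<bullet> y \<le> x \<bullet> y" if "f \<in> ?G" for f
    using g(2)[OF that] max_id[of g] g by simp
  moreover have "reflection_word ns x \<bullet> y \<noteq> x \<bullet> y"
    using max_id[OF mem(2)] le assms(2) by auto
  ultimately show ?thesis using mem(2) by (simp add: less_le)
qed

text \<open>The closed case is the limit of the open one: \<open>y\<close> is replaced by
  \<open>y + t *\<^sub>R y0\<close>, and \<open>t\<close> tends to 0 from above.\<close>

lemma word_inner_le: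
  assumes "set ns \<subseteq> N"
    and x: "\<And>n. n \<in> N \<Longrightarrow> 0 < n \<bullet> x" and y: "\<And>n. n \<in> N \<Longrightarrow> 0 \<le> n \<bullet> y"
  shows "reflection_word ns x \<bullet> y \<le> x \<bullet> y"
proof (cases "reflection_word ns = id")
  case False
  let ?d = "x - reflection_word ns x"
  have *: "0 \<le> ?d \<bullet> (y + t *\<^sub>R y0)" if "0 < t" for t
  proof -
    have "0 < n \<bullet> (y + t *\<^sub>R y0)" if "n \<in> N" for n
      using y[OF that] normalized[OF that] \<open>0 < t\<close> by (simp add: inner_add_right)
    from word_inner_less[OF assms(1) False x this] show ?thesis by (simp add: inner_diff_left)
  qed
  have "((\<lambda>t. ?d \<bullet> (y + t *\<^sub>R y0)) \<longlongrightarrow> ?d \<bullet> (y + 0 *\<^sub>R y0)) (at_right 0)"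
    by (intro tendsto_intros)
  then have "0 \<le> ?d \<bullet> (y + 0 *\<^sub>R y0)"
    by (rule tendsto_lowerbound) (auto simp: eventually_at_right_less * eventually_at_filter)
  then show ?thesis by (simp add: inner_diff_left)
qed simp

end

section \<open>Chambers\<close>

text \<open>A point avoiding the old hyperplanes is moved along the new normal \<open>a\<close>:
  each form is constant along this line or vanishes at a single parameter.\<close>

lemma avoid_hyperplanes:
  fixes A :: "'w::real_inner set"
  assumes "finite A" "0 \<notin> A"
  shows "\<exists>z. \<forall>a\<in>A. a \<bullet> z \<noteq> 0"
  using assms
proof (induction A)
  case (insert a A)
  then obtain z where z: "\<And>b. b \<in> A \<Longrightarrow> b \<bullet> z \<noteq> 0" by auto
  \<comment> \<open>The zeros of the forms along the line; a form orthogonal to \<open>a\<close>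
    contributes only a harmless 0, the value of division by zero.\<close>
  define bad where "bad = (\<lambda>b. - (b \<bullet> z) / (b \<bullet> a)) ` insert a A"
  have "finite bad" using insert by (simp add: bad_def)
  then obtain t where t: "t \<notin> bad" "t \<noteq> 0"
    using ex_new_if_finite[OF infinite_UNIV_char_0, of "insert 0 bad"] by auto
  have "b \<bullet> (z + t *\<^sub>R a) \<noteq> 0" if "b \<in> insert a A" for b
  proof (cases "b \<bullet> a = 0")
    case True
    then have "b \<in> A" using that insert.prems by auto
    then show ?thesis using z True by (simp add: inner_add_right)
  next
    case False
    have "t \<noteq> - (b \<bullet> z) / (b \<bullet> a)" using t(1) that by (auto simp: bad_def)
    then show ?thesis using False by (simp add: inner_add_right field_simps add_eq_0_iff)
  qed
  then show ?case by blast
qed simp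

text \<open>The prolonged point stays in the affine hull and, for small \<open>e\<close>, in the
  neighborhood \<open>T\<close>. Later this turns weak inequalities on a cone into strict ones on
  its relative interior.\<close>

lemma rel_interior_prolong:
  fixes S :: "'v::real_normed_vector set"
  assumes "x \<in> rel_interior S" "y \<in> S"
  shows "\<exists>e>0. x + e *\<^sub>R (x - y) \<in> S"
proof -
  obtain T where T: "open T" "x \<in> T" "x \<in> S" "T \<inter> affine hull S \<subseteq> S"
    using assms(1) by (auto simp: mem_rel_interior)
  have "((\<lambda>e. x + e *\<^sub>R (x - y)) \<longlongrightarrow> x + 0 *\<^sub>R (x - y)) (at_right 0)"
    by (intro tendsto_intros)
  then have "eventually (\<lambda>e. x + e *\<^sub>R (x - y) \<in> T) (at_right 0)"
    using T by (auto dest: topological_tendstoD)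
  then have "eventually (\<lambda>e. 0 < e \<and> x + e *\<^sub>R (x - y) \<in> T) (at_right 0)"
    using eventually_at_right_less[of "0::real"] by (rule eventually_elim2) simp
  then obtain e :: real where e: "0 < e" "x + e *\<^sub>R (x - y) \<in> T"
    using eventually_happens'[OF trivial_limit_at_right_real] by blast
  have "x + e *\<^sub>R (x - y) = (1 + e) *\<^sub>R x + (- e) *\<^sub>R y" by (simp add: algebra_simps)
  also have "\<dots> \<in> affine hull S"
    using T(3) assms(2) by (intro mem_affine[OF affine_affine_hull]) (auto intro: hull_inc)
  finally show ?thesis using e T(4) by blast
qed

text \<open>A chamber is given only as a maximal cone of the fan, so its full dimension must be
  derived. A point off every hyperplane that does not contain \<open>\<Phi>\<close> is perturbed in
  a generic direction \<open>z\<close>; taking the side of \<open>z\<close> at the remaining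
  hyperplanes gives a fan cone containing \<open>\<Phi>\<close>, equal to it by maximality.\<close>

lemma chamber_interior_point:
  fixes \<H> :: "'w::real_inner set set"
  assumes fin: "finite \<H>" and hyp: "\<forall>h\<in>\<H>. linear_hyperplane h" and ch: "chamber \<H> \<Phi>"
  shows "\<exists>y0\<in>\<Phi>. \<forall>h\<in>\<H>. y0 \<notin> h"
proof -
  obtain c where c: "\<Phi> = (\<Inter>h\<in>\<H>. c h)" "\<And>h. h \<in> \<H> \<Longrightarrow> c h = h \<or> c h \<in> closed_halfspaces h"
    using ch by (auto simp: chamber_def arrangement_fan_def)
  have "\<exists>a. a \<noteq> 0 \<and> (\<forall>x. x \<in> h \<longleftrightarrow> a \<bullet> x = 0)" if h: "h \<in> \<H>" for h
  proof -
    obtain a where "a \<noteq> 0" "h = {x. a \<bullet> x = 0}"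
      using bspec[OF hyp h] unfolding linear_hyperplane_def by (elim exE conjE)
    then show ?thesis by (intro exI[of _ a]) simp
  qed
  then obtain a where a: "\<And>h. h \<in> \<H> \<Longrightarrow> a h \<noteq> 0" "\<And>h x. h \<in> \<H> \<Longrightarrow> x \<in> h \<longleftrightarrow> a h \<bullet> x = 0"
    by metis
  obtain z where z: "\<And>h. h \<in> \<H> \<Longrightarrow> a h \<bullet> z \<noteq> 0"
    using avoid_hyperplanes[of "a ` \<H>"] fin a by force
  define \<H>0 where "\<H>0 = {h \<in> \<H>. \<Phi> \<subseteq> h}"
  have "\<exists>b. (\<forall>x. x \<in> h \<longleftrightarrow> b \<bullet> x = 0) \<and> (\<forall>x. x \<in> c h \<longleftrightarrow> 0 \<le> b \<bullet> x)" if "h \<in> \<H> - \<H>0" for h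
  proof -
    have "\<not> \<Phi> \<subseteq> h" "\<Phi> \<subseteq> c h" using that c(1) by (auto simp: \<H>0_def)
    then have "c h \<in> closed_halfspaces h" using c(2)[of h] that by auto
    then obtain b where "h = {x. b \<bullet> x = 0}" "c h = {x. 0 \<le> b \<bullet> x}"
      unfolding closed_halfspaces_def mem_Collect_eq by (elim exE conjE)
    then have "\<And>x. x \<in> h \<longleftrightarrow> b \<bullet> x = 0" "\<And>x. x \<in> c h \<longleftrightarrow> 0 \<le> b \<bullet> x" by (simp, blast)
    then show ?thesis by (intro exI[of _ b]) simp
  qed
  then obtain b where b: "\<And>h x. h \<in> \<H> - \<H>0 \<Longrightarrow> x \<in> h \<longleftrightarrow> b h \<bullet> x = 0"
      "\<And>h x. h \<in> \<H> - \<H>0 \<Longrightarrow> x \<in> c h \<longleftrightarrow> 0 \<le> b h \<bullet> x"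
    by metis
  have "\<forall>h\<in>\<H> - \<H>0. \<exists>p\<in>\<Phi>. p \<notin> h" by (auto simp: \<H>0_def)
  then obtain p where p: "\<And>h. h \<in> \<H> - \<H>0 \<Longrightarrow> p h \<in> \<Phi> \<and> p h \<notin> h" by metis
  \<comment> \<open>Each \<open>b h\<close> is nonnegative on all summands and positive on
    \<open>p h\<close>, so the sum avoids all these hyperplanes at once.\<close>
  define q where "q = (\<Sum>h\<in>\<H> - \<H>0. p h)"
  have finD: "finite (\<H> - \<H>0)" using fin by simp
  have bnn: "0 \<le> b h \<bullet> x" if "h \<in> \<H> - \<H>0" "x \<in> \<Phi>" for h x
    using b(2)[OF that(1)] that c(1) by auto
  have q: "0 < b h \<bullet> q" if h: "h \<in> \<H> - \<H>0" for h
  proof -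
    have "b h \<bullet> p h \<noteq> 0" using b(1)[OF h] p[OF h] by blast
    then have "0 < b h \<bullet> p h" using bnn[OF h] p[OF h] by (metis less_le)
    also have "\<dots> \<le> (\<Sum>k\<in>\<H> - \<H>0. b h \<bullet> p k)"
      using bnn[OF h] p h finD by (intro member_le_sum) auto
    finally show ?thesis by (simp add: q_def inner_sum_right)
  qed
  have qn: "a h \<bullet> q = 0" if h: "h \<in> \<H>0" for h
  proof -
    have "a h \<bullet> x = 0" if "x \<in> \<Phi>" for x
    proof -
      have "x \<in> h" using that h by (auto simp: \<H>0_def)
      then show ?thesis using a(2)[of h] h by (auto simp: \<H>0_def)
    qed
    then show ?thesis using p unfolding q_def inner_sum_right by (intro sum.neutral) auto
  qed
  have "eventually (\<lambda>t. \<forall>h\<in>\<H> - \<H>0. 0 < b h \<bullet> (q + t *\<^sub>R z)) (at_right 0)"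
  proof (intro eventually_ball_finite finD ballI)
    fix h assume h: "h \<in> \<H> - \<H>0"
    have "((\<lambda>t. b h \<bullet> (q + t *\<^sub>R z)) \<longlongrightarrow> b h \<bullet> (q + 0 *\<^sub>R z)) (at_right 0)"
      by (intro tendsto_intros)
    then show "eventually (\<lambda>t. 0 < b h \<bullet> (q + t *\<^sub>R z)) (at_right 0)"
      using q[OF h] by (intro order_tendstoD) auto
  qed
  then have "eventually (\<lambda>t. 0 < t \<and> (\<forall>h\<in>\<H> - \<H>0. 0 < b h \<bullet> (q + t *\<^sub>R z))) (at_right 0)"
    using eventually_at_right_less[of "0::real"] by eventually_elim simp
  then obtain t :: real where t: "0 < t" "\<And>h. h \<in> \<H> - \<H>0 \<Longrightarrow> 0 < b h \<bullet> (q + t *\<^sub>R z)"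
    using eventually_happens'[OF trivial_limit_at_right_real] by blast
  define y where "y = q + t *\<^sub>R z"
  \<comment> \<open>The normal \<open>(a h \<bullet> z) *\<^sub>R a h\<close> has the square of
    \<open>a h \<bullet> z\<close> as its value at \<open>z\<close>, so it selects the side of
    \<open>h\<close> that contains \<open>z\<close>.\<close>
  define c' where "c' h = (if h \<in> \<H>0 then {x. 0 \<le> ((a h \<bullet> z) *\<^sub>R a h) \<bullet> x} else c h)" for h
  have yc: "y \<in> c' h" if "h \<in> \<H>" for h
  proof (cases "h \<in> \<H>0")
    case True
    then show ?thesis using qn[OF True] t(1) by (auto simp: y_def c'_def inner_add_right zero_le_mult_iff mult_le_0_iff)
  next
    case False
    then show ?thesis using t(2)[of h] b(2)[of h] that by (auto simp: y_def c'_def)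
  qed
  have "c' h = h \<or> c' h \<in> closed_halfspaces h" if h: "h \<in> \<H>" for h
  proof (cases "h \<in> \<H>0")
    case True
    let ?d = "(a h \<bullet> z) *\<^sub>R a h"
    have "?d \<noteq> 0" "h = {x. ?d \<bullet> x = 0}" using a(1)[OF h] a(2)[OF h] z[OF h] by auto
    moreover have "c' h = {x. 0 \<le> ?d \<bullet> x}" by (simp only: c'_def True if_True)
    ultimately show ?thesis unfolding closed_halfspaces_def by blast
  next
    case False
    then show ?thesis using c(2)[OF h] by (simp add: c'_def)
  qed
  then have mem: "(\<Inter>h\<in>\<H>. c' h) \<in> arrangement_fan \<H>" by (auto simp: arrangement_fan_def)
  have "\<Phi> \<subseteq> c' h" if h: "h \<in> \<H>" for h
  proof (cases "h \<in> \<H>0")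
    case True
    then have "\<Phi> \<subseteq> {x. a h \<bullet> x = 0}" using a(2)[OF h] by (auto simp: \<H>0_def)
    then show ?thesis using True by (auto simp: c'_def)
  next
    case False
    then show ?thesis using c(1) h by (auto simp: c'_def)
  qed
  then have "\<Phi> \<subseteq> (\<Inter>h\<in>\<H>. c' h)" by blast
  then have "y \<in> \<Phi>" using mem ch yc by (auto simp: chamber_def)
  moreover have "y \<notin> h" if h: "h \<in> \<H>" for h
  proof (cases "h \<in> \<H>0")
    case True
    have "a h \<bullet> y \<noteq> 0" using qn[OF True] t(1) z[OF h] by (simp add: y_def inner_add_right)
    then show ?thesis using a(2)[OF h] by blast
  next
    case False
    have "0 < b h \<bullet> y" using t(2)[of h] h False by (simp add: y_def)
    then show ?thesis using b(1)[of h] h False by auto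
  qed
  ultimately show ?thesis by blast
qed

text \<open>One normal per hyperplane, oriented towards \<open>y0\<close>: the positive roots
  belonging to the chamber around \<open>y0\<close>.\<close>

definition normals_at :: "'w::real_inner set set \<Rightarrow> 'w \<Rightarrow> 'w set" where
  "normals_at \<H> y0 = {n. n \<bullet> y0 = 1 \<and> {x. n \<bullet> x = 0} \<in> \<H>}"

lemma normal_of_hyperplane:
  assumes "a \<noteq> 0" "{x. a \<bullet> x = 0} \<in> \<H>" "\<forall>h\<in>\<H>. y0 \<notin> h"
  shows "(1 / (a \<bullet> y0)) *\<^sub>R a \<in> normals_at \<H> y0" "a \<bullet> y0 \<noteq> 0"
proof -
  show *: "a \<bullet> y0 \<noteq> 0" using bspec[OF assms(3,2)] by simp
  then have "{x. ((1 / (a \<bullet> y0)) *\<^sub>R a) \<bullet> x = 0} = {x. a \<bullet> x = 0}" by auto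
  then show "(1 / (a \<bullet> y0)) *\<^sub>R a \<in> normals_at \<H> y0" using * assms by (simp add: normals_at_def)
qed

text \<open>A point of \<open>\<Phi>\<close> off the hyperplanes rules out choosing a hyperplane
  itself, so every constraint is a half-space whose normal is positive at \<open>y0\<close> and can
  be rescaled.\<close>

lemma chamber_eq_normals:
  assumes hyp: "\<forall>h\<in>\<H>. linear_hyperplane h" and ch: "chamber \<H> \<Phi>"
    and y0: "y0 \<in> \<Phi>" "\<forall>h\<in>\<H>. y0 \<notin> h"
  shows "\<Phi> = {x. \<forall>n\<in>normals_at \<H> y0. 0 \<le> n \<bullet> x}"
proof -
  obtain c where c: "\<Phi> = (\<Inter>h\<in>\<H>. c h)" "\<And>h. h \<in> \<H> \<Longrightarrow> c h = h \<or> c h \<in> closed_halfspaces h"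
    using ch by (auto simp: chamber_def arrangement_fan_def)
  have half: "\<exists>a. a \<noteq> 0 \<and> h = {x. a \<bullet> x = 0} \<and> c h = {x. 0 \<le> a \<bullet> x} \<and> 0 < a \<bullet> y0"
    if h: "h \<in> \<H>" for h
  proof -
    have "y0 \<in> c h" "y0 \<notin> h" using y0 c(1) h by auto
    then have "c h \<in> closed_halfspaces h" using c(2)[OF h] by auto
    then obtain a where a: "a \<noteq> 0" "h = {x. a \<bullet> x = 0}" "c h = {x. 0 \<le> a \<bullet> x}"
      unfolding closed_halfspaces_def mem_Collect_eq by (elim exE conjE)
    have "0 \<le> a \<bullet> y0" "a \<bullet> y0 \<noteq> 0" using \<open>y0 \<in> c h\<close> \<open>y0 \<notin> h\<close> a(2,3) by blast+
    then have "0 < a \<bullet> y0" by simp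
    with a show ?thesis by blast
  qed
  show ?thesis
  proof (intro subset_antisym subsetI CollectI ballI)
    fix x n assume x: "x \<in> \<Phi>" and n: "n \<in> normals_at \<H> y0"
    let ?h = "{x. n \<bullet> x = 0}"
    have h: "?h \<in> \<H>" "n \<bullet> y0 = 1" using n by (auto simp: normals_at_def)
    obtain a where a: "a \<noteq> 0" "?h = {x. a \<bullet> x = 0}" "c ?h = {x. 0 \<le> a \<bullet> x}" "0 < a \<bullet> y0"
      using half[OF h(1)] by auto
    obtain d where d: "n = d *\<^sub>R a" using normals_parallel[OF a(2,1)] by auto
    have "0 < d" using d h(2) a(4) by (metis inner_scaleR_left zero_less_mult_pos2 zero_less_one)
    moreover have "0 \<le> a \<bullet> x" using x c(1) h(1) a(3) by blast
    ultimately show "0 \<le> n \<bullet> x" using d by simp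
  next
    fix x assume x: "x \<in> {x. \<forall>n\<in>normals_at \<H> y0. 0 \<le> n \<bullet> x}"
    have "x \<in> c h" if h: "h \<in> \<H>" for h
    proof -
      obtain a where a: "a \<noteq> 0" "h = {x. a \<bullet> x = 0}" "c h = {x. 0 \<le> a \<bullet> x}" "0 < a \<bullet> y0"
        using half[OF h] by auto
      have "0 \<le> ((1 / (a \<bullet> y0)) *\<^sub>R a) \<bullet> x"
        using normal_of_hyperplane[of a \<H> y0] a(1,2) h y0 x by blast
      then show ?thesis using a(3,4) by (simp add: zero_le_divide_iff)
    qed
    then show "x \<in> \<Phi>" using c(1) by blast
  qed
qed

section \<open>The reflection group as a set of words\<close>

lemma mult_GL: "f \<otimes>\<^bsub>GL\<^esub> g = f \<circ> g" and one_GL: "\<one>\<^bsub>GL\<^esub> = id"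
  by (simp_all add: GL_def)

lemma bij_reflection: "bij (reflection a)"
  by (rule o_bij[of "reflection a"]) (auto simp: fun_eq_iff)

lemma inv_reflection_GL: "inv\<^bsub>GL\<^esub> (reflection a) = reflection a"
  unfolding m_inv_def
proof (rule the_equality)
  show "reflection a \<in> carrier GL \<and> reflection a \<otimes>\<^bsub>GL\<^esub> reflection a = \<one>\<^bsub>GL\<^esub> \<and>
      reflection a \<otimes>\<^bsub>GL\<^esub> reflection a = \<one>\<^bsub>GL\<^esub>"
    using linear_reflection bij_reflection by (auto simp: GL_def fun_eq_iff)
next
  fix y assume "y \<in> carrier GL \<and> reflection a \<otimes>\<^bsub>GL\<^esub> y = \<one>\<^bsub>GL\<^esub> \<and> y \<otimes>\<^bsub>GL\<^esub> reflection a = \<one>\<^bsub>GL\<^esub>"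
  then have "reflection a \<circ> y = id" by (simp add: GL_def)
  then show "y = reflection a" by (metis comp_apply eq_id_iff ext reflection_involutive)
qed

text \<open>Rescaling a normal does not change its reflection, and each generator is its own
  inverse, so words in normalized normals exhaust the group.\<close>

lemma reflection_group_eq_words:
  assumes "\<forall>h\<in>\<H>. y0 \<notin> h"
  shows "reflection_group \<H> = {reflection_word ns | ns. set ns \<subseteq> normals_at \<H> y0}" (is "_ = ?R")
proof (intro subset_antisym subsetI)
  have refl: "reflection a \<in> ?R" if a: "a \<noteq> 0" "{x. a \<bullet> x = 0} \<in> \<H>" for a
  proof -
    note n = normal_of_hyperplane[OF a assms]
    have "reflection a = reflection_word [(1 / (a \<bullet> y0)) *\<^sub>R a]"
      using n(2) reflection_scaleR_normal[of "1 / (a \<bullet> y0)" a] by simp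
    then show ?thesis using n(1) by (intro CollectI exI[of _ "[(1 / (a \<bullet> y0)) *\<^sub>R a]"]) simp
  qed
  fix g assume "g \<in> reflection_group \<H>"
  then have "g \<in> generate GL {reflection a | a. a \<noteq> 0 \<and> {x. a \<bullet> x = 0} \<in> \<H>}"
    by (simp add: reflection_group_def)
  then show "g \<in> ?R"
  proof (induction rule: generate.induct)
    case one
    show ?case by (intro CollectI exI[of _ "[]"]) (simp add: one_GL)
  next
    case (incl h)
    then show ?case using refl by blast
  next
    case (inv h)
    then obtain a where "h = reflection a" "a \<noteq> 0" "{x. a \<bullet> x = 0} \<in> \<H>" by blast
    then show ?case using refl by (simp add: inv_reflection_GL)
  next
    case (eng h1 h2)
    then obtain ms ns where "h1 = reflection_word ms" "h2 = reflection_word ns"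
      "set ms \<subseteq> normals_at \<H> y0" "set ns \<subseteq> normals_at \<H> y0" by blast
    then show ?case by (intro CollectI exI[of _ "ms @ ns"]) (simp add: mult_GL)
  qed
next
  fix g assume "g \<in> ?R"
  then obtain ns where "g = reflection_word ns" "set ns \<subseteq> normals_at \<H> y0" by blast
  then show "g \<in> reflection_group \<H>"
  proof (induction ns arbitrary: g)
    case Nil
    then show ?case
      using generate.one[of GL] by (simp only: reflection_group_def one_GL reflection_word_Nil)
  next
    case (Cons n ns)
    have "n \<bullet> y0 = 1" "{x. n \<bullet> x = 0} \<in> \<H>" using Cons.prems(2) by (auto simp: normals_at_def)
    then have "reflection n \<in> generate GL {reflection a | a. a \<noteq> 0 \<and> {x. a \<bullet> x = 0} \<in> \<H>}"
      by (intro generate.incl) force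
    moreover have "reflection_word ns \<in> generate GL {reflection a | a. a \<noteq> 0 \<and> {x. a \<bullet> x = 0} \<in> \<H>}"
      using Cons by (simp add: reflection_group_def)
    ultimately show ?case using generate.eng[of "reflection n" GL _ "reflection_word ns"] Cons.prems(1)
      by (simp only: reflection_group_def mult_GL reflection_word_Cons)
  qed
qed

text \<open>A reflection takes the hyperplane of \<open>m\<close> to the one with normal
  \<open>reflection n m\<close>, which is in \<open>\<H>\<close> by invariance. Finiteness of the
  normals holds because a hyperplane determines its normal with value 1 at
  \<open>y0\<close>.\<close>

lemma reflection_normals_at:
  assumes "finite \<H>" and y0: "\<forall>h\<in>\<H>. y0 \<notin> h"
    and "finite (reflection_group \<H>)" and inv: "\<forall>g\<in>reflection_group \<H>. \<forall>h\<in>\<H>. g ` h \<in> \<H>"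
  shows "reflection_normals (normals_at \<H> y0) y0"
proof
  let ?N = "normals_at \<H> y0"
  show "n \<bullet> y0 = 1" if "n \<in> ?N" for n using that by (simp add: normals_at_def)
  have "inj_on (\<lambda>n. {x. n \<bullet> x = 0}) ?N"
  proof (rule inj_onI)
    fix m n assume mn: "m \<in> ?N" "n \<in> ?N" "{x. m \<bullet> x = 0} = {x. n \<bullet> x = 0}"
    then have "m \<bullet> y0 = 1" "n \<bullet> y0 = 1" by (auto simp: normals_at_def)
    moreover obtain c where "m = c *\<^sub>R n"
      using normals_parallel[OF mn(3)] \<open>n \<bullet> y0 = 1\<close> by force
    ultimately show "m = n" by simp
  qed
  moreover have "finite ((\<lambda>n. {x. n \<bullet> x = 0}) ` ?N)"
    by (rule finite_subset[OF _ \<open>finite \<H>\<close>]) (auto simp: normals_at_def)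
  ultimately show "finite ?N" by (rule finite_imageD[rotated])
  show "finite {reflection_word ns | ns. set ns \<subseteq> ?N}"
    using assms reflection_group_eq_words[OF y0] by simp
  show "\<exists>c k. k \<in> ?N \<and> reflection n m = c *\<^sub>R k" if m: "m \<in> ?N" and n: "n \<in> ?N" for m n
  proof -
    have "reflection n \<in> reflection_group \<H>"
      unfolding reflection_group_eq_words[OF y0] using n by (intro CollectI exI[of _ "[n]"]) simp
    moreover have "{x. m \<bullet> x = 0} \<in> \<H>" using m by (simp add: normals_at_def)
    ultimately have "reflection n ` {x. m \<bullet> x = 0} \<in> \<H>" using inv by blast
    moreover have "reflection n ` {x. m \<bullet> x = 0} = {x. reflection n m \<bullet> x = 0}"
    proof (intro subset_antisym subsetI)
      fix x assume "x \<in> {x. reflection n m \<bullet> x = 0}"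
      then show "x \<in> reflection n ` {x. m \<bullet> x = 0}"
        by (intro image_eqI[of _ _ "reflection n x"]) (simp_all add: reflection_inner_swap)
    qed (auto simp: reflection_inner_reflection)
    ultimately have h: "{x. reflection n m \<bullet> x = 0} \<in> \<H>" by simp
    \<comment> \<open>A zero image would make the set in \<open>h\<close> the whole space, which
      contains \<open>y0\<close>.\<close>
    have "reflection n m \<noteq> 0"
      using y0 h by force
    note k = normal_of_hyperplane[OF this h y0]
    show ?thesis using k
      by (intro exI[of _ "reflection n m \<bullet> y0"] exI[of _ "(1 / (reflection n m \<bullet> y0)) *\<^sub>R reflection n m"]) simp
  qed
qed

section \<open>The quotient and its dual affine space\<close>

locale dual_spaces =
  fixes V :: "'a::euclidean_space set" and x0 :: 'a and \<pi> :: "'a \<Rightarrow> 'w::real_inner"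
  assumes subspace_V: "subspace V" and x0_orthogonal: "x0 \<in> V\<^sup>\<bottom>"
    and projection: "quotient_projection V \<pi>"
begin

abbreviation "U \<equiv> affine_translate V x0"

lemma linear_pi: "linear \<pi>"
  and surj_pi: "surj \<pi>"
  and pi_eq_0_iff: "\<pi> x = 0 \<longleftrightarrow> x \<in> V\<^sup>\<bottom>"
  and pi_inner: "v \<in> V \<Longrightarrow> v' \<in> V \<Longrightarrow> \<pi> v \<bullet> \<pi> v' = v \<bullet> v'"
  using projection by (auto simp: quotient_projection_def)

lemma pi_x0: "\<pi> x0 = 0"
  using x0_orthogonal pi_eq_0_iff by simp

lemma orthogonal_inner: "z \<in> V\<^sup>\<bottom> \<Longrightarrow> v \<in> V \<Longrightarrow> v \<bullet> z = 0"
  by (simp add: orthogonal_comp_def orthogonal_def)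

lemma mem_U_iff: "u \<in> U \<longleftrightarrow> u - x0 \<in> V"
  by (force simp: affine_translate_def image_iff)

lemma affine_U: "affine U"
  using affine_translation[of V x0] subspace_imp_affine[OF subspace_V]
  by (simp add: affine_translate_def add.commute)

lemma pi_inj_on_V:
  assumes "v \<in> V" "v' \<in> V" "\<pi> v = \<pi> v'" shows "v = v'"
proof -
  have d: "v - v' \<in> V" using assms subspace_V subspace_diff by blast
  moreover have "v - v' \<in> V\<^sup>\<bottom>"
    using assms pi_eq_0_iff linear_diff[OF linear_pi, of v v'] by simp
  ultimately have "(v - v') \<bullet> (v - v') = 0" by (metis orthogonal_inner)
  then show ?thesis by simp
qed

lemma pi_section_ex1: "\<exists>!v. v \<in> V \<and> \<pi> v = \<omega>"
proof -
  obtain x where x: "\<omega> = \<pi> x" using surj_pi by blast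
  obtain y z where yz: "y \<in> span V" "\<And>w. w \<in> span V \<Longrightarrow> orthogonal z w" "x = y + z"
    using orthogonal_subspace_decomp_exists by metis
  have "y \<in> V" using yz(1) subspace_V span_eq_iff by metis
  moreover have "\<pi> z = 0"
    using yz(2) by (auto simp: pi_eq_0_iff orthogonal_comp_def orthogonal_commute span_base)
  then have "\<pi> y = \<omega>" using x yz(3) linear_add[OF linear_pi, of y z] by simp
  ultimately show ?thesis using pi_inj_on_V by blast
qed

text \<open>The section of \<open>\<pi>\<close> with values in \<open>V\<close>; it represents
  functionals by vectors of the ambient euclidean space, where results on half-spaces and faces
  apply.\<close>

definition lift :: "'w \<Rightarrow> 'a" where
  "lift \<omega> = (THE v. v \<in> V \<and> \<pi> v = \<omega>)"

lemma lift_mem [simp]: "lift \<omega> \<in> V" and pi_lift [simp]: "\<pi> (lift \<omega>) = \<omega>"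
  using theI'[OF pi_section_ex1, of \<omega>] by (auto simp: lift_def)

lemma lift_pi: "v \<in> V \<Longrightarrow> lift (\<pi> v) = v"
  using pi_inj_on_V lift_mem pi_lift by blast

lemma linear_lift: "linear lift"
proof (rule linearI)
  show "lift (x + y) = lift x + lift y" for x y
    by (rule pi_inj_on_V) (simp_all add: subspace_add subspace_V linear_add[OF linear_pi])
  show "lift (c *\<^sub>R x) = c *\<^sub>R lift x" for c x
    by (rule pi_inj_on_V) (simp_all add: subspace_scale subspace_V linear_scale[OF linear_pi])
qed

text \<open>\<open>lift\<close> is adjoint to \<open>\<pi>\<close>, because \<open>u\<close> and
  \<open>lift (\<pi> u)\<close> differ by a vector orthogonal to \<open>V\<close> and
  \<open>\<pi>\<close> is isometric on \<open>V\<close>.\<close>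

lemma lift_inner: "lift \<omega> \<bullet> u = \<omega> \<bullet> \<pi> u"
proof -
  have "u - lift (\<pi> u) \<in> V\<^sup>\<bottom>"
    by (simp add: linear_diff[OF linear_pi] flip: pi_eq_0_iff)
  then have "lift \<omega> \<bullet> (u - lift (\<pi> u)) = 0" by (simp add: orthogonal_inner)
  then have "lift \<omega> \<bullet> u = lift \<omega> \<bullet> lift (\<pi> u)" by (simp add: inner_diff_right)
  then show ?thesis using pi_inner[of "lift \<omega>" "lift (\<pi> u)"] by simp
qed

text \<open>The chosen representative is determined up to \<open>V\<^sup>\<bottom>\<close>, which is
  orthogonal to \<open>u - x0\<close>, so \<open>lift \<omega>\<close> may replace it.\<close>

lemma pairing_eq:
  assumes "u \<in> U" shows "pairing \<pi> x0 \<omega> u = \<omega> \<bullet> \<pi> u"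
proof -
  let ?w = "SOME w. \<pi> w = \<omega>"
  have w: "\<pi> ?w = \<omega>" using someI[of "\<lambda>w. \<pi> w = \<omega>", OF pi_lift] .
  have "?w - lift \<omega> \<in> V\<^sup>\<bottom>"
    by (simp add: w linear_diff[OF linear_pi] flip: pi_eq_0_iff)
  then have "(u - x0) \<bullet> (?w - lift \<omega>) = 0" using assms orthogonal_inner mem_U_iff by blast
  then have "?w \<bullet> (u - x0) = lift \<omega> \<bullet> (u - x0)" by (simp add: inner_diff_right inner_commute)
  then show ?thesis
    by (simp add: pairing_def lift_inner linear_diff[OF linear_pi] pi_x0)
qed

text \<open>Maps of the quotient are carried over to \<open>U\<close> along \<open>\<pi>\<close>,
  whose inverse on \<open>U\<close> is \<open>lift\<close> followed by adding
  \<open>x0\<close>.\<close>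

definition act :: "('w \<Rightarrow> 'w) \<Rightarrow> 'a \<Rightarrow> 'a" where
  "act f u = x0 + lift (f (\<pi> u))"

lemma act_mem [simp]: "act f u \<in> U"
  by (simp add: mem_U_iff act_def)

lemma pi_act [simp]: "\<pi> (act f u) = f (\<pi> u)"
  by (simp add: act_def linear_add[OF linear_pi] pi_x0)

lemma pi_inj_on_U:
  assumes "u \<in> U" "u' \<in> U" "\<pi> u = \<pi> u'" shows "u = u'"
  using pi_inj_on_V[of "u - x0" "u' - x0"] assms
  by (simp add: mem_U_iff linear_diff[OF linear_pi])

lemma act_act: "act f (act h u) = act (f \<circ> h) u"
  by (rule pi_inj_on_U) simp_all

lemma act_id: "u \<in> U \<Longrightarrow> act id u = u"
  by (rule pi_inj_on_U) simp_all

lemma act_convex_combination: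
  assumes "linear f"
  shows "act f ((1 - t) *\<^sub>R a + t *\<^sub>R b) = (1 - t) *\<^sub>R act f a + t *\<^sub>R act f b"
proof -
  define L where "L = lift \<circ> f \<circ> \<pi>"
  have L: "linear L"
    unfolding L_def using linear_compose linear_pi linear_lift assms by metis
  have act: "act f u = x0 + L u" for u by (simp add: act_def L_def)
  show ?thesis
    unfolding act linear_add[OF L] linear_scale[OF L] by (simp add: algebra_simps)
qed

text \<open>The right action of \<open>g\<close> is the left action of its adjoint \<open>h\<close>;
  for a word the adjoint is the reversed word.\<close>

lemma right_act_eq:
  assumes "u \<in> U" "\<And>\<omega> \<xi>. g \<omega> \<bullet> \<xi> = \<omega> \<bullet> h \<xi>"
  shows "right_act V \<pi> x0 u g = act h u"
  unfolding right_act_def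
proof (rule the_equality)
  show "act h u \<in> U \<and> (\<forall>\<omega>. pairing \<pi> x0 (g \<omega>) u = pairing \<pi> x0 \<omega> (act h u))"
    using assms by (simp add: pairing_eq)
next
  fix u' assume u': "u' \<in> U \<and> (\<forall>\<omega>. pairing \<pi> x0 (g \<omega>) u = pairing \<pi> x0 \<omega> u')"
  then have "\<omega> \<bullet> \<pi> u' = \<omega> \<bullet> h (\<pi> u)" for \<omega>
    using assms by (simp add: pairing_eq)
  then have "(\<pi> u' - h (\<pi> u)) \<bullet> (\<pi> u' - h (\<pi> u)) = 0"
    by (simp add: inner_diff_right)
  then show "u' = act h u" using u' by (intro pi_inj_on_U) simp_all
qed

end

section \<open>Extreme points and faces of convex hulls\<close>

lemma extreme_point_of_affine_image:
  assumes ext: "x extreme_point_of S" and mem: "\<rho> x \<in> S"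
    and affine': "\<And>a b t. \<rho>' ((1 - t) *\<^sub>R a + t *\<^sub>R b) = (1 - t) *\<^sub>R \<rho>' a + t *\<^sub>R \<rho>' b"
    and maps: "\<And>a. a \<in> S \<Longrightarrow> \<rho>' a \<in> S"
    and inverse: "\<And>a. a \<in> S \<Longrightarrow> \<rho>' (\<rho> a) = a" "\<And>a. a \<in> S \<Longrightarrow> \<rho> (\<rho>' a) = a"
  shows "\<rho> x extreme_point_of S"
  unfolding extreme_point_of_def
proof (intro conjI mem ballI notI)
  fix a b assume ab: "a \<in> S" "b \<in> S" "\<rho> x \<in> open_segment a b"
  then obtain t where t: "a \<noteq> b" "0 < t" "t < 1" "\<rho> x = (1 - t) *\<^sub>R a + t *\<^sub>R b"
    by (auto simp: in_segment)
  have "x \<in> S" using ext by (simp add: extreme_point_of_def)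
  then have "x = \<rho>' (\<rho> x)" using inverse by simp
  \<comment> \<open>The segment through \<open>\<rho> x\<close> is pulled back by the affine inverse
    to a segment through \<open>x\<close>.\<close>
  then have "x = (1 - t) *\<^sub>R \<rho>' a + t *\<^sub>R \<rho>' b" using t(4) affine' by simp
  moreover have "\<rho>' a \<noteq> \<rho>' b" using inverse(2) ab t(1) by metis
  ultimately have "x \<in> open_segment (\<rho>' a) (\<rho>' b)" using t by (auto simp: in_segment)
  then show False using ext maps ab by (auto simp: extreme_point_of_def)
qed

lemma extreme_point_of_subset:
  "x extreme_point_of T \<Longrightarrow> S \<subseteq> T \<Longrightarrow> x \<in> S \<Longrightarrow> x extreme_point_of S"
  by (auto simp: extreme_point_of_def)

text \<open>In a combination of a point of \<open>P\<close> and one of the hull of \<open>R\<close>,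
  any positive weight on the latter pushes the value strictly below \<open>c\<close>.\<close>

lemma convex_hull_Int_supporting_hyperplane:
  fixes P :: "'a::euclidean_space set"
  assumes "convex P" "P \<noteq> {}" "\<And>x. x \<in> P \<Longrightarrow> a \<bullet> x = c" "\<And>x. x \<in> R \<Longrightarrow> a \<bullet> x < c"
  shows "convex hull (P \<union> R) \<inter> {x. a \<bullet> x = c} = P"
proof (cases "R = {}")
  case True
  then show ?thesis using assms by (auto simp: hull_same)
next
  case False
  then have ne: "convex hull R \<noteq> {}" by simp
  have "P \<union> R \<subseteq> P \<union> convex hull R" using hull_subset[of R convex] by blast
  then have sub: "convex hull (P \<union> R) \<subseteq> convex hull (P \<union> convex hull R)" by (rule hull_mono)
  have "convex hull R \<subseteq> {x. a \<bullet> x < c}"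
    using assms(4) by (intro hull_minimal convex_halfspace_lt) auto
  then have lt: "a \<bullet> r < c" if "r \<in> convex hull R" for r using that by auto
  have "x \<in> P" if x: "x \<in> convex hull (P \<union> R)" "a \<bullet> x = c" for x
  proof -
    have "x \<in> {u *\<^sub>R s + v *\<^sub>R t | u v s t. u \<ge> 0 \<and> v \<ge> 0 \<and> u + v = 1 \<and> s \<in> P \<and> t \<in> convex hull R}"
      using subsetD[OF sub x(1)]
      unfolding convex_hull_union_two[OF assms(1,2) convex_convex_hull ne] .
    then obtain u v p r where x': "x = u *\<^sub>R p + v *\<^sub>R r" "0 \<le> u" "0 \<le> v" "u + v = 1"
      "p \<in> P" "r \<in> convex hull R" by blast
    have "v * (c - a \<bullet> r) = c * (u + v) - a \<bullet> x"
      using assms(3)[OF x'(5)] by (simp add: x'(1) inner_add_right algebra_simps)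
    then have "v = 0" using x'(4) x(2) lt[OF x'(6)] by simp
    then show ?thesis using x' by simp
  qed
  moreover have "P \<subseteq> convex hull (P \<union> R)" using hull_subset[of "P \<union> R" convex] by blast
  ultimately show ?thesis using assms(3) by blast
qed

section \<open>Symmetrized polytopes\<close>

text \<open>The geometric hypotheses in terms of normals: \<open>P_positive\<close> comes from
  appropriateness, \<open>w0\<close> witnesses placedness, and \<open>essential\<close> says that
  the hyperplanes meet only in the origin.\<close>

locale symmetrized_polytope = dual_spaces V x0 \<pi> + reflection_normals N y0
  for V :: "'a::euclidean_space set" and x0 :: 'a and \<pi> :: "'a \<Rightarrow> 'w::real_inner"
    and N :: "'w set" and y0 :: 'w +
  fixes P :: "'a set" and w0 :: 'w
  assumes polytope_P: "polytope P" and P_nonempty: "P \<noteq> {}" and P_subset_U: "P \<subseteq> U"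
    and P_positive: "\<And>x n. x \<in> P \<Longrightarrow> n \<in> N \<Longrightarrow> 0 < n \<bullet> \<pi> x"
    and w0_positive: "\<And>n. n \<in> N \<Longrightarrow> 0 < n \<bullet> w0"
    and w0_constant: "\<And>x y. x \<in> P \<Longrightarrow> y \<in> P \<Longrightarrow> w0 \<bullet> \<pi> x = w0 \<bullet> \<pi> y"
    and essential: "\<And>w. (\<And>n. n \<in> N \<Longrightarrow> n \<bullet> w = 0) \<Longrightarrow> w = 0"
begin

text \<open>Although written with the left action, this is also the orbit under the right action,
  since reversed words give the same group.\<close>

definition "orbit = {act (reflection_word ns) x | ns x. set ns \<subseteq> N \<and> x \<in> P}"

definition "K = convex hull orbit"

lemma act_word_rev:
  assumes "u \<in> U"
  shows "act (reflection_word (rev ns)) (act (reflection_word ns) u) = u"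
    "act (reflection_word ns) (act (reflection_word (rev ns)) u) = u"
  using assms by (auto intro!: pi_inj_on_U)

lemma orbit_subset_K: "orbit \<subseteq> K"
  by (simp add: K_def hull_subset)

lemma act_P_mem_K: "set ns \<subseteq> N \<Longrightarrow> x \<in> P \<Longrightarrow> act (reflection_word ns) x \<in> K"
  using orbit_subset_K by (auto simp: orbit_def)

lemma P_subset_orbit: "P \<subseteq> orbit"
proof
  fix x assume "x \<in> P"
  moreover from this have "x = act (reflection_word []) x" using P_subset_U act_id[of x] by auto
  ultimately show "x \<in> orbit"
    unfolding orbit_def by (intro CollectI exI[of _ "[]"] exI[of _ x]) simp
qed

lemma P_subset_K: "P \<subseteq> K"
  using P_subset_orbit orbit_subset_K by blast

lemma K_subset_U: "K \<subseteq> U"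
  unfolding K_def using affine_U by (intro hull_minimal affine_imp_convex) (auto simp: orbit_def)

text \<open>The points sent into \<open>K\<close> form a convex set, as the action is affine, and
  this set contains the orbit by concatenation of words.\<close>

lemma act_K:
  assumes "set ns \<subseteq> N" "u \<in> K" shows "act (reflection_word ns) u \<in> K"
proof -
  let ?f = "act (reflection_word ns)"
  have "convex {u. ?f u \<in> K}"
    using convexD_alt[OF convex_convex_hull[of orbit]]
    by (auto simp: convex_alt K_def act_convex_combination[OF linear_reflection_word])
  moreover have "orbit \<subseteq> {u. ?f u \<in> K}"
  proof (intro subsetI CollectI)
    fix u assume "u \<in> orbit"
    then obtain ms x where "u = act (reflection_word ms) x" "set ms \<subseteq> N" "x \<in> P"
      by (auto simp: orbit_def)
    then show "?f u \<in> K"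
      using assms(1) act_P_mem_K[of "ns @ ms" x] by (simp add: act_act)
  qed
  ultimately have "K \<subseteq> {u. ?f u \<in> K}" unfolding K_def by (intro hull_minimal)
  then show ?thesis using assms(2) by blast
qed

lemma K_halfspace:
  assumes "\<And>u. u \<in> orbit \<Longrightarrow> f \<bullet> \<pi> u \<le> c" "u \<in> K" shows "f \<bullet> \<pi> u \<le> c"
proof -
  have "K \<subseteq> {u. lift f \<bullet> u \<le> c}"
    unfolding K_def using assms(1) by (intro hull_minimal convex_halfspace_le) (auto simp: lift_inner)
  then show ?thesis using assms(2) by (auto simp: lift_inner)
qed

lemma polytope_K: "polytope K"
proof -
  obtain E where E: "finite E" "P = convex hull E" using polytope_P by (auto simp: polytope_def)
  define G where "G = {reflection_word ns | ns. set ns \<subseteq> N}"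
  define F where "F = (\<Union>g\<in>G. act g ` E)"
  have "finite F" using finite_words E(1) by (simp add: F_def G_def)
  have "orbit \<subseteq> convex hull F"
  proof
    fix u assume "u \<in> orbit"
    then obtain ns x where u: "u = act (reflection_word ns) x" "set ns \<subseteq> N" "x \<in> P"
      by (auto simp: orbit_def)
    let ?f = "act (reflection_word ns)"
    have "reflection_word ns \<in> G" using u(2) by (auto simp: G_def)
    then have "E \<subseteq> {x. ?f x \<in> convex hull F}" by (auto simp: F_def intro!: hull_inc)
    moreover have "convex {x. ?f x \<in> convex hull F}"
      using convexD_alt[OF convex_convex_hull[of F]]
      by (auto simp: convex_alt act_convex_combination[OF linear_reflection_word])
    ultimately have "P \<subseteq> {x. ?f x \<in> convex hull F}" unfolding E(2) by (intro hull_minimal)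
    then show "u \<in> convex hull F" using u by blast
  qed
  then have "K \<subseteq> convex hull F" unfolding K_def by (intro hull_minimal convex_convex_hull)
  moreover have "F \<subseteq> orbit"
  proof
    fix u assume "u \<in> F"
    then obtain ns x where u: "u = act (reflection_word ns) x" "set ns \<subseteq> N" "x \<in> E"
      by (auto simp: F_def G_def)
    then have "x \<in> P" using E(2) hull_inc[of x E convex] by simp
    then show "u \<in> orbit" unfolding orbit_def using u by blast
  qed
  then have "convex hull F \<subseteq> K" unfolding K_def by (rule hull_mono)
  ultimately have "K = convex hull F" by blast
  then show ?thesis using \<open>finite F\<close> by (auto simp: polytope_def)
qed

text \<open>This is the cone formula for the trivial group element, with the chamber expressed by
  its normals.\<close>

lemma normal_cone_K_iff:
  assumes "v \<in> P"
  shows "(\<forall>u\<in>K. f \<bullet> \<pi> u \<le> f \<bullet> \<pi> v) \<longleftrightarrow>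
    (\<forall>n\<in>N. 0 \<le> n \<bullet> f) \<and> (\<forall>x\<in>P. f \<bullet> \<pi> x \<le> f \<bullet> \<pi> v)" (is "?L \<longleftrightarrow> ?R")
proof
  assume L: ?L
  have "0 \<le> n \<bullet> f" if n: "n \<in> N" for n
  proof -
    have "act (reflection_word [n]) v \<in> K" using act_P_mem_K[of "[n]" v] n assms by simp
    with L have "f \<bullet> \<pi> (act (reflection_word [n]) v) \<le> f \<bullet> \<pi> v" by blast
    then have "0 \<le> (2 * (n \<bullet> \<pi> v) / (n \<bullet> n)) * (n \<bullet> f)"
      by (simp add: reflection_def inner_diff_right inner_commute)
    moreover have "0 < 2 * (n \<bullet> \<pi> v) / (n \<bullet> n)"
      using P_positive[OF assms n] normal_nonzero[OF n] by simp
    ultimately show ?thesis by (simp only: zero_le_mult_iff) linarith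
  qed
  then show ?R using L P_subset_K by blast
next
  assume R: ?R
  have "f \<bullet> \<pi> u \<le> f \<bullet> \<pi> v" if "u \<in> orbit" for u
  proof -
    obtain ns x where u: "u = act (reflection_word ns) x" "set ns \<subseteq> N" "x \<in> P"
      using \<open>u \<in> orbit\<close> by (auto simp: orbit_def)
    \<comment> \<open>\<open>\<pi> x\<close> is in the open chamber and \<open>f\<close> only in the
      closed one, so undoing the group element does not decrease \<open>f\<close>.\<close>
    have "reflection_word ns (\<pi> x) \<bullet> f \<le> \<pi> x \<bullet> f"
      using u(2) P_positive[OF u(3)] R by (intro word_inner_le) auto
    then have "f \<bullet> \<pi> u \<le> f \<bullet> \<pi> x" using u(1) by (simp add: inner_commute)
    also have "\<dots> \<le> f \<bullet> \<pi> v" using R u(3) by blast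
    finally show ?thesis .
  qed
  then show ?L using K_halfspace by blast
qed

text \<open>Invariance of \<open>K\<close> reduces this to the trivial element: the reversed word
  acting on points becomes the word itself acting on \<open>f\<close>.\<close>

lemma normal_cone_act_K_iff:
  assumes "v \<in> P" "set ns \<subseteq> N"
  shows "(\<forall>u\<in>K. f \<bullet> \<pi> u \<le> f \<bullet> \<pi> (act (reflection_word (rev ns)) v)) \<longleftrightarrow>
    (\<forall>n\<in>N. 0 \<le> n \<bullet> reflection_word ns f) \<and>
    (\<forall>x\<in>P. reflection_word ns f \<bullet> \<pi> x \<le> reflection_word ns f \<bullet> \<pi> v)"
proof -
  have eq: "f \<bullet> \<pi> (act (reflection_word (rev ns)) u) = reflection_word ns f \<bullet> \<pi> u" for u
    by (simp add: reflection_word_inner_swap)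
  have im: "act (reflection_word (rev ns)) ` K = K"
  proof (intro subset_antisym subsetI)
    fix u assume u: "u \<in> K"
    then show "u \<in> act (reflection_word (rev ns)) ` K"
      using act_word_rev(1)[of u ns] act_K[OF assms(2) u] K_subset_U by (metis image_eqI subsetD)
  qed (use act_K[of "rev ns"] assms(2) in auto)
  have "(\<forall>u\<in>K. f \<bullet> \<pi> u \<le> f \<bullet> \<pi> (act (reflection_word (rev ns)) v)) \<longleftrightarrow>
      (\<forall>u\<in>act (reflection_word (rev ns)) ` K. f \<bullet> \<pi> u \<le> f \<bullet> \<pi> (act (reflection_word (rev ns)) v))"
    by (simp only: im)
  also have "\<dots> \<longleftrightarrow> (\<forall>u\<in>K. reflection_word ns f \<bullet> \<pi> u \<le> reflection_word ns f \<bullet> \<pi> v)"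
    by (simp only: ball_simps eq)
  also note normal_cone_K_iff[OF assms(1)]
  finally show ?thesis .
qed

lemma P_face_of_K: "P face_of K"
proof -
  obtain p where p: "p \<in> P" using P_nonempty by blast
  have P: "lift w0 \<bullet> x = w0 \<bullet> \<pi> p" if "x \<in> P" for x
    using w0_constant[OF that p] by (simp add: lift_inner)
  have R: "lift w0 \<bullet> u < w0 \<bullet> \<pi> p" if mem: "u \<in> orbit - P" for u
  proof -
    obtain ns x where u: "u = act (reflection_word ns) x" "set ns \<subseteq> N" "x \<in> P"
      using mem by (auto simp: orbit_def)
    \<comment> \<open>The identity would give a point of \<open>P\<close>, so the strict inequality
      applies to every orbit point outside \<open>P\<close>.\<close>
    have "reflection_word ns \<noteq> id"
      using mem u act_id[of x] P_subset_U by auto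
    then have "reflection_word ns (\<pi> x) \<bullet> w0 < \<pi> x \<bullet> w0"
      using u(2) P_positive[OF u(3)] w0_positive by (intro word_inner_less) auto
    then show ?thesis using u(1) w0_constant[OF u(3) p] by (simp add: lift_inner inner_commute)
  qed
  have K: "K = convex hull (P \<union> (orbit - P))" using P_subset_orbit by (simp add: K_def Un_absorb1)
  have "K \<inter> {x. lift w0 \<bullet> x = w0 \<bullet> \<pi> p} = P"
    unfolding K using P R P_nonempty polytope_imp_convex[OF polytope_P]
    by (intro convex_hull_Int_supporting_hyperplane) auto
  moreover have "K \<subseteq> {x. lift w0 \<bullet> x \<le> w0 \<bullet> \<pi> p}"
    unfolding K using P R by (intro hull_minimal convex_halfspace_le) (force simp: less_imp_le)
  ultimately show ?thesis
    using face_of_Int_supporting_hyperplane_le[of K "lift w0" "w0 \<bullet> \<pi> p"] polytope_imp_convex[OF polytope_K]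
    by auto
qed

lemma extreme_point_act_K:
  assumes "set ns \<subseteq> N" "x extreme_point_of K"
  shows "act (reflection_word ns) x extreme_point_of K"
proof (rule extreme_point_of_affine_image[OF assms(2), where \<rho>' = "act (reflection_word (rev ns))"])
  have "x \<in> K" using assms(2) by (simp add: extreme_point_of_def)
  then show "act (reflection_word ns) x \<in> K" using act_K assms(1) by blast
qed (use assms(1) act_K[of "rev ns"] act_word_rev K_subset_U in
    \<open>auto simp: act_convex_combination[OF linear_reflection_word]\<close>)

text \<open>An extreme point of the hull lies in the orbit and can be moved back into
  \<open>P\<close>, where it stays extreme. Conversely, vertices of the face \<open>P\<close> are
  extreme in \<open>K\<close>, and the group permutes extreme points.\<close>

lemma extreme_points_K:
  "{v. v extreme_point_of K} =
    {act (reflection_word (rev ns)) v | v ns. v extreme_point_of P \<and> set ns \<subseteq> N}"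
proof (intro subset_antisym subsetI CollectI)
  fix u assume "u \<in> {v. v extreme_point_of K}"
  then have u: "u extreme_point_of K" by simp
  then have "u \<in> orbit" unfolding K_def by (rule extreme_point_of_convex_hull)
  then obtain ns x where x: "u = act (reflection_word ns) x" "set ns \<subseteq> N" "x \<in> P"
    by (auto simp: orbit_def)
  have "act (reflection_word (rev ns)) u extreme_point_of K"
    using extreme_point_act_K[of "rev ns"] u x(2) by simp
  then have "x extreme_point_of K" using x P_subset_U act_word_rev(1)[of x ns] by auto
  then have "x extreme_point_of P" using extreme_point_of_subset P_subset_K x(3) by blast
  then show "\<exists>v ns. u = act (reflection_word (rev ns)) v \<and> v extreme_point_of P \<and> set ns \<subseteq> N"
    using x by (intro exI[of _ x] exI[of _ "rev ns"]) simp
next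
  fix u assume "u \<in> {act (reflection_word (rev ns)) v | v ns. v extreme_point_of P \<and> set ns \<subseteq> N}"
  then obtain v ns where u: "u = act (reflection_word (rev ns)) v" "v extreme_point_of P" "set ns \<subseteq> N"
    by blast
  then have "v extreme_point_of K" using extreme_point_of_face[OF P_face_of_K] by blast
  then show "u extreme_point_of K" using extreme_point_act_K[of "rev ns" v] u by simp
qed

text \<open>Both \<open>f\<close> and \<open>- f\<close> are maximal at a point of \<open>P\<close>,
  so both lie in the chamber, which is pointed.\<close>

lemma constant_functional_0:
  assumes "\<And>u u'. u \<in> K \<Longrightarrow> u' \<in> K \<Longrightarrow> f \<bullet> \<pi> u = f \<bullet> \<pi> u'"
  shows "f = 0"
proof (rule essential)
  fix n assume n: "n \<in> N"
  obtain v where v: "v \<in> P" using P_nonempty by blast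
  then have eq: "f \<bullet> \<pi> u = f \<bullet> \<pi> v" if "u \<in> K" for u
    using assms that P_subset_K by blast
  have "\<forall>u\<in>K. f \<bullet> \<pi> u \<le> f \<bullet> \<pi> v" by (intro ballI eq_refl eq)
  moreover have "\<forall>u\<in>K. (- f) \<bullet> \<pi> u \<le> (- f) \<bullet> \<pi> v"
    unfolding inner_minus_left by (intro ballI eq_refl arg_cong[of _ _ uminus] eq)
  ultimately have "0 \<le> n \<bullet> f" "0 \<le> n \<bullet> (- f)"
    using normal_cone_K_iff[OF v] n by blast+
  then show "n \<bullet> f = 0" by simp
qed

text \<open>If the directions of \<open>K\<close> spanned less than \<open>V\<close>, a nonzero
  vector of \<open>V\<close> orthogonal to them would give a nonzero functional constant on
  \<open>K\<close>.\<close>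

lemma aff_dim_K: "aff_dim K = aff_dim U"
proof -
  obtain p where p: "p \<in> P" using P_nonempty by blast
  have pK: "p \<in> K" and pU: "p \<in> U" using p P_subset_K P_subset_U by auto
  let ?D = "(+) (- p) ` K"
  have D: "?D \<subseteq> V"
  proof
    fix d assume "d \<in> ?D"
    then obtain u where u: "u \<in> K" "d = u - p" by auto
    then have "(u - x0) - (p - x0) \<in> V"
      using pU K_subset_U subspace_diff[OF subspace_V] by (meson mem_U_iff subsetD)
    then show "d \<in> V" using u by simp
  qed
  have V: "(+) (- p) ` U = V"
  proof (intro subset_antisym subsetI)
    fix d assume "d \<in> (+) (- p) ` U"
    then obtain u where u: "u \<in> U" "d = u - p" by auto
    then have "(u - x0) - (p - x0) \<in> V"
      using pU subspace_diff[OF subspace_V] by (meson mem_U_iff)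
    then show "d \<in> V" using u by simp
  next
    fix d assume "d \<in> V"
    then have "d + (p - x0) \<in> V" using pU subspace_add[OF subspace_V] by (meson mem_U_iff)
    then have "d + p \<in> U" by (simp add: mem_U_iff algebra_simps)
    then show "d \<in> (+) (- p) ` U" by (intro image_eqI[of _ _ "d + p"]) simp_all
  qed
  have "span ?D = V"
  proof (rule ccontr)
    assume ne: "span ?D \<noteq> V"
    have "span ?D \<subset> span V"
      using ne span_minimal[OF D subspace_V] subspace_V by (simp add: psubset_eq span_eq_iff[THEN iffD2])
    then obtain d where d: "d \<noteq> 0" "d \<in> span V" "\<And>y. y \<in> span ?D \<Longrightarrow> orthogonal d y"
      using orthogonal_to_subspace_exists_gen by blast
    have dV: "d \<in> V" using d(2) subspace_V span_eq_iff by metis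
    have "\<pi> d \<bullet> \<pi> u = d \<bullet> u" for u
      using lift_inner[of "\<pi> d" u] lift_pi[OF dV] by simp
    moreover have "d \<bullet> u = d \<bullet> p" if "u \<in> K" for u
      using d(3)[of "- p + u"] span_base[of "- p + u" ?D] that
      by (simp add: orthogonal_def inner_diff_right)
    ultimately have "\<pi> d = 0" by (intro constant_functional_0) simp
    then show False
      using d(1) lift_pi[OF dV] linear_0[OF linear_lift] by simp
  qed
  then have "dim ?D = dim V" by (metis dim_span)
  then show ?thesis
    using aff_dim_eq_dim[of p K] aff_dim_eq_dim[of p U] pK pU V by (simp add: hull_inc)
qed

end

theorem theorem3p13:
  fixes V :: "'a::euclidean_space set" and x0 :: 'a
    and \<pi> :: "'a \<Rightarrow> 'w::real_inner"
    and \<H> :: "'w set set" and \<Phi> :: "'w set" and P :: "'a set"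
  defines "U \<equiv> affine_translate V x0"
    and "G \<equiv> reflection_group \<H>"
    and "\<Psi> \<equiv> dual_cone V \<pi> x0 \<Phi>"
    and "verts \<equiv> {v. v extreme_point_of P}"
    and "GP \<equiv> symmetrization V \<pi> x0 (reflection_group \<H>) P"
  assumes "subspace V" and "x0 \<in> V\<^sup>\<bottom>"
    and "quotient_projection V \<pi>"
    and "finite \<H>" and "\<forall>h\<in>\<H>. linear_hyperplane h" and "\<exists>p. \<Inter>\<H> = {p}"
    and "finite G" and "\<forall>g\<in>G. \<forall>h\<in>\<H>. g ` h \<in> \<H>"
    and "chamber \<H> \<Phi>"
    and "polytope P" and "P \<noteq> {}" and "P \<subseteq> U"
    and "placed \<pi> x0 \<Phi> P" and "appropriate \<Psi> P"
  shows "{v. v extreme_point_of GP} = {right_act V \<pi> x0 v g | v g. v \<in> verts \<and> g \<in> G} \<and>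
    (\<forall>v\<in>verts. \<forall>g\<in>G. ncone \<pi> x0 {right_act V \<pi> x0 v g} GP = \<kappa> \<pi> x0 \<Phi> P v g) \<and>
    (polytope GP \<and> GP \<subseteq> U \<and> aff_dim GP = aff_dim U)"
proof -
  note finite_H = assms(9) and hyperplanes = assms(10) and chamber = assms(14)
  interpret dual_spaces V x0 \<pi> by (intro dual_spaces.intro assms(6-8))
  obtain y0 where y0: "y0 \<in> \<Phi>" "\<forall>h\<in>\<H>. y0 \<notin> h"
    using chamber_interior_point[OF finite_H hyperplanes chamber] by (elim bexE)
  define N where "N = normals_at \<H> y0"
  have \<Phi>: "\<Phi> = {x. \<forall>n\<in>N. 0 \<le> n \<bullet> x}"
    unfolding N_def by (rule chamber_eq_normals[OF hyperplanes chamber y0])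
  have G: "G = {reflection_word ns | ns. set ns \<subseteq> N}"
    unfolding N_def G_def by (rule reflection_group_eq_words[OF y0(2)])
  interpret reflection_normals N y0
    unfolding N_def
    by (rule reflection_normals_at[OF finite_H y0(2) assms(12,13)[unfolded G_def]])
  \<comment> \<open>Since \<open>n \<bullet> y0 = 1\<close>, prolonging beyond \<open>x\<close> away
    from \<open>y0\<close> costs \<open>e\<close>; staying in \<open>\<Phi>\<close> therefore leaves
    \<open>n \<bullet> x\<close> strictly positive.\<close>
  have pos: "0 < n \<bullet> x" if "n \<in> N" "0 < e" "x + e *\<^sub>R (x - y0) \<in> \<Phi>" for n x and e :: real
  proof -
    have "0 \<le> n \<bullet> (x + e *\<^sub>R (x - y0))" using that \<Phi> by blast
    then have "e \<le> (1 + e) * (n \<bullet> x)"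
      using normalized[OF \<open>n \<in> N\<close>] by (simp add: inner_add_right inner_diff_right algebra_simps)
    then show ?thesis using \<open>0 < e\<close> by (smt (verit) zero_less_mult_iff)
  qed
  obtain w0 where w0: "w0 \<in> rel_interior \<Phi>" "pairing \<pi> x0 w0 constant_on P"
    using assms(18) unfolding placed_def constancy_space_def by blast
  \<comment> \<open>The point of \<open>U\<close> lying over \<open>y0\<close>; the constant map
    makes \<open>act\<close> serve as the inverse of \<open>\<pi>\<close> on
    \<open>U\<close>.\<close>
  define u0 where "u0 = act (\<lambda>_. y0) x0"
  have u0: "u0 \<in> \<Psi>" using y0(1) by (simp add: u0_def \<Psi>_def dual_cone_def)
  interpret symmetrized_polytope V x0 \<pi> N y0 P w0
  proof
    show "polytope P" "P \<noteq> {}" "P \<subseteq> affine_translate V x0"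
      using assms(15-17) by (simp_all add: U_def)
    show "0 < n \<bullet> \<pi> x" if "x \<in> P" "n \<in> N" for x n
    proof -
      have "x \<in> rel_interior \<Psi>" using assms(19) that(1) unfolding appropriate_def by blast
      then obtain e where e: "e > 0" "x + e *\<^sub>R (x - u0) \<in> \<Psi>"
        using rel_interior_prolong u0 by blast
      then have "\<pi> x + e *\<^sub>R (\<pi> x - y0) \<in> \<Phi>"
        by (simp add: \<Psi>_def dual_cone_def u0_def linear_add[OF linear_pi]
            linear_diff[OF linear_pi] linear_scale[OF linear_pi])
      then show ?thesis using pos[OF that(2) e(1)] by blast
    qed
    show "0 < n \<bullet> w0" if "n \<in> N" for n
      using rel_interior_prolong[OF w0(1) y0(1)] pos[OF that] by blast
    show "w0 \<bullet> \<pi> x = w0 \<bullet> \<pi> y" if "x \<in> P" "y \<in> P" for x y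
    proof -
      have "x \<in> affine_translate V x0" "y \<in> affine_translate V x0" using that assms(17) by (auto simp: U_def)
      moreover have "pairing \<pi> x0 w0 x = pairing \<pi> x0 w0 y"
        using w0(2) that unfolding constant_on_def by metis
      ultimately show ?thesis by (simp add: pairing_eq)
    qed
    show "w = 0" if "\<And>n. n \<in> N \<Longrightarrow> n \<bullet> w = 0" for w
    proof -
      obtain p where p: "\<Inter>\<H> = {p}" using assms(11) by blast
      \<comment> \<open>A vector on which all normals vanish lies in every hyperplane;
        \<open>w\<close> and 0 are two such vectors, and the intersection is a single point.\<close>
      have mem: "z \<in> \<Inter>\<H>" if z: "\<And>n. n \<in> N \<Longrightarrow> n \<bullet> z = 0" for z
      proof
        fix h assume h: "h \<in> \<H>"
        obtain a where a: "a \<noteq> 0" "h = {x. a \<bullet> x = 0}"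
          using bspec[OF hyperplanes h] unfolding linear_hyperplane_def by (elim exE conjE)
        note n = normal_of_hyperplane[OF a(1) h[unfolded a(2)] y0(2)]
        have "((1 / (a \<bullet> y0)) *\<^sub>R a) \<bullet> z = 0" using z n(1) unfolding N_def by blast
        then show "z \<in> h" using n(2) a(2) by auto
      qed
      show ?thesis using mem[of w] mem[of 0] that p by simp
    qed
  qed
  have act: "right_act V \<pi> x0 v (reflection_word ns) = act (reflection_word (rev ns)) v"
    if "v \<in> P" for v ns
    using that P_subset_U by (intro right_act_eq reflection_word_inner_swap) auto
  have "{right_act V \<pi> x0 x g | x g. g \<in> G \<and> x \<in> P} = orbit"
  proof (intro subset_antisym subsetI)
    fix u assume "u \<in> {right_act V \<pi> x0 x g | x g. g \<in> G \<and> x \<in> P}"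
    then obtain x ns where "u = act (reflection_word (rev ns)) x" "set (rev ns) \<subseteq> N" "x \<in> P"
      using act by (auto simp: G)
    then show "u \<in> orbit" unfolding orbit_def by blast
  next
    fix u assume "u \<in> orbit"
    then obtain ns x where u: "u = act (reflection_word ns) x" "set ns \<subseteq> N" "x \<in> P"
      by (auto simp: orbit_def)
    then have "u = right_act V \<pi> x0 x (reflection_word (rev ns))"
      using act[of x "rev ns"] by simp
    moreover have "reflection_word (rev ns) \<in> G"
      unfolding G using u(2) by (intro CollectI exI[of _ "rev ns"]) simp
    ultimately show "u \<in> {right_act V \<pi> x0 x g | x g. g \<in> G \<and> x \<in> P}" using u(3) by blast
  qed
  then have GP: "GP = K" by (simp add: GP_def G_def symmetrization_def K_def)
  have vert: "v \<in> P" if "v extreme_point_of P" for v using that by (simp add: extreme_point_of_def)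
  have "{v. v extreme_point_of GP} = {right_act V \<pi> x0 v g | v g. v \<in> verts \<and> g \<in> G}"
  proof (intro subset_antisym subsetI)
    fix u assume "u \<in> {v. v extreme_point_of GP}"
    then obtain v ns where "u = right_act V \<pi> x0 v (reflection_word ns)" "v \<in> verts" "set ns \<subseteq> N"
      unfolding GP extreme_points_K verts_def using act vert by auto
    then show "u \<in> {right_act V \<pi> x0 v g | v g. v \<in> verts \<and> g \<in> G}"
      unfolding G by blast
  next
    fix u assume "u \<in> {right_act V \<pi> x0 v g | v g. v \<in> verts \<and> g \<in> G}"
    then obtain v ns where "u = right_act V \<pi> x0 v (reflection_word ns)" "v \<in> verts" "set ns \<subseteq> N"
      unfolding G by blast
    then show "u \<in> {v. v extreme_point_of GP}"
      unfolding GP extreme_points_K verts_def using act vert by auto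
  qed
  moreover have "ncone \<pi> x0 {right_act V \<pi> x0 v g} GP = \<kappa> \<pi> x0 \<Phi> P v g"
    if v: "v \<in> verts" and g: "g \<in> G" for v g
  proof -
    have vP: "v \<in> P" using v vert by (simp add: verts_def)
    obtain ns where ns: "g = reflection_word ns" "set ns \<subseteq> N" using g G by blast
    have inU: "\<And>u. u \<in> K \<Longrightarrow> u \<in> affine_translate V x0" "\<And>u. u \<in> P \<Longrightarrow> u \<in> affine_translate V x0"
      using K_subset_U P_subset_U by auto
    show ?thesis
    proof (rule Set.set_eqI)
      fix f
      have "f \<in> ncone \<pi> x0 {right_act V \<pi> x0 v g} GP \<longleftrightarrow>
          (\<forall>u\<in>K. f \<bullet> \<pi> u \<le> f \<bullet> \<pi> (act (reflection_word (rev ns)) v))"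
        unfolding ncone_def GP ns(1) act[OF vP]
        by (simp add: pairing_eq inU(1) del: pi_act cong: ball_cong)
      \<comment> \<open>Membership in the two preimages under \<open>g\<close> is exactly the pair
        of conditions on \<open>reflection_word ns f\<close>.\<close>
      also have "\<dots> \<longleftrightarrow> f \<in> \<kappa> \<pi> x0 \<Phi> P v g"
        unfolding normal_cone_act_K_iff[OF vP ns(2)] \<kappa>_def ncone_def \<Phi> ns(1)
        by (simp add: pairing_eq inU(2) vP cong: ball_cong)
      finally show "f \<in> ncone \<pi> x0 {right_act V \<pi> x0 v g} GP \<longleftrightarrow> f \<in> \<kappa> \<pi> x0 \<Phi> P v g" .
    qed
  qed
  ultimately show ?thesis
    using polytope_K K_subset_U aff_dim_K unfolding GP U_def by blast
qed

end
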